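(* For every positive integer $n$ there exists a bijection $\phi\colon \mathrm{zRTT}_0(n)\to \mathrm{zLD}^2(n)$ such that for every $T\in\mathrm{zRTT}_0(n)$ we have $\alpha(\phi(T))=\alpha(T)$ and $\beta(\phi(T))=\mathrm{rev}(\beta(T))$.
   Context: A tiered rooted tree on $n+1$ vertices is a tree $T$ with vertex set $V$, $|V|=n+1$, a distinguished root $r\in V$, and two functions $w$ (label) and $\mathrm{lv}$ (level) on $V$ with $w(r)=\mathrm{lv}(r)=0$ and $w(v),\mathrm{lv}(v)\in\mathbb{Z}_{\ge 1}$ for $v\neq r$, such that: (1) for every edge $\{u,v\}$ with $u,v\neq r$ we have $w(u)\neq w(v)$, $\mathrm{lv}(u)\ne\mathrm{lv}(v)$, and $w(u)<w(v)\iff \mathrm{lv}(u)<\mathrm{lv}(v)$; (2) any two distinct vertices with the same parent have different pairs $(w,\mathrm{lv})$. (Edges incident to the root are unconstrained.) Trees are considered up to isomorphism preserving root, labels and levels. The parent $p(v)$ of $v\neq r$ is its neighbour closer to $r$; $u$ is a descendant of $v$ (and $v$ an ancestor of $u$) if $v=p^k(u)$ for some $k>0$. Two vertices $u,v$ are compatible, written $u\bowtie v$, if either ($\mathrm{lv}(u)<\mathrm{lv}(v)$ and $w(u)<w(v)$) or ($\mathrm{lv}(u)>\mathrm{lv}(v)$ and $w(u)>w(v)$). A pair $(u,v)$ of non-root vertices is an inversion if $v$ is a descendant of $u$, $v\bowtie p(u)$, and either $w(v)<w(u)$ or ($w(v)=w(u)$ and $\mathrm{lv}(v)>\mathrm{lv}(u)$).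 $\mathrm{zRTT}_0(n)$ is the set of tiered rooted trees on $n+1$ vertices with no inversions. For such $T$, $\alpha(T)$ (resp. $\beta(T)$) is the weak composition whose $i$-th entry ($i\ge1$) is the number of non-root vertices with label $i$ (resp. level $i$). $\mathrm{zLD}^2(n)$ is the set of pairs of sequences $(a,b)$ with $a=(a_1,\dots,a_n)$, $b=(b_1,\dots,b_n)$ of positive integers such that for each $1\le i\le n-1$, $a_i<a_{i+1}$ or $b_i<b_{i+1}$ (these are exactly the $2$-labelled Dyck paths of size $n$ with area $0$). For $(a,b)\in\mathrm{zLD}^2(n)$, $\alpha(a,b)_i=\#\{j: a_j=i\}$ and $\beta(a,b)_i=\#\{j:b_j=i\}$. For a weak composition $\beta$ with some nonzero entry, let $s$ be the smallest and $m$ the largest index with $\beta_s\ne0$, $\beta_m\neq 0$; $\mathrm{rev}(\beta)$ is the weak composition with $\mathrm{rev}(\beta)_i=\beta_{s+m-i}$ for $s\le i\le m$ and $0$ otherwise. *)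

theory Defs
  imports Main
begin

text \<open>Labels and levels are meaningful on \<^term>\<open>verts T\<close> only; the values elsewhere are
  junk, which the isomorphism relation below ignores.\<close>

record 'v rtree =
  verts :: "'v set"
  edges :: "'v set set"
  rt :: 'v
  label :: "'v \<Rightarrow> nat"
  level :: "'v \<Rightarrow> nat"

definition walk :: "'v rtree \<Rightarrow> 'v \<Rightarrow> 'v list \<Rightarrow> 'v \<Rightarrow> bool" where
  "walk T u xs v \<longleftrightarrow> xs \<noteq> [] \<and> hd xs = u \<and> last xs = v \<and> set xs \<subseteq> verts T \<and>
     successively (\<lambda>x y. {x, y} \<in> edges T) xs"

definition is_tree :: "'v rtree \<Rightarrow> bool" where
  "is_tree T \<longleftrightarrow> finite (verts T) \<and> verts T \<noteq> {} \<and>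
     (\<forall>e\<in>edges T. \<exists>u\<in>verts T. \<exists>v\<in>verts T. u \<noteq> v \<and> e = {u, v}) \<and>
     (\<forall>u\<in>verts T. \<forall>v\<in>verts T. \<exists>xs. walk T u xs v) \<and>
     \<not> (\<exists>u xs v. walk T u xs v \<and> distinct xs \<and> length xs \<ge> 3 \<and> {v, u} \<in> edges T)"

text \<open>A walk listing \<^term>\<open>Suc k\<close> vertices has length \<^term>\<open>k\<close>.\<close>

definition depth :: "'v rtree \<Rightarrow> 'v \<Rightarrow> nat" where
  "depth T v = (LEAST k. \<exists>xs. walk T (rt T) xs v \<and> length xs = Suc k)"

definition nonroot :: "'v rtree \<Rightarrow> 'v set" where
  "nonroot T = verts T - {rt T}"

text \<open>Only meaningful for \<^term>\<open>v \<in> nonroot T\<close>.\<close>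

definition parent :: "'v rtree \<Rightarrow> 'v \<Rightarrow> 'v" where
  "parent T v = (THE u. {u, v} \<in> edges T \<and> depth T u < depth T v)"

definition descendant :: "'v rtree \<Rightarrow> 'v \<Rightarrow> 'v \<Rightarrow> bool" where
  "descendant T u v \<longleftrightarrow> (u, v) \<in> {(x, parent T x) | x. x \<in> nonroot T}\<^sup>+"

definition tiered_rooted_tree :: "'v rtree \<Rightarrow> bool" where
  "tiered_rooted_tree T \<longleftrightarrow> is_tree T \<and> rt T \<in> verts T \<and>
     label T (rt T) = 0 \<and> level T (rt T) = 0 \<and>
     (\<forall>v\<in>nonroot T. label T v \<ge> 1 \<and> level T v \<ge> 1) \<and>
     (\<forall>u\<in>nonroot T. \<forall>v\<in>nonroot T. {u, v} \<in> edges T \<longrightarrow>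
        label T u \<noteq> label T v \<and> level T u \<noteq> level T v \<and>
        (label T u < label T v \<longleftrightarrow> level T u < level T v)) \<and>
     (\<forall>u\<in>nonroot T. \<forall>v\<in>nonroot T. u \<noteq> v \<and> parent T u = parent T v \<longrightarrow>
        (label T u, level T u) \<noteq> (label T v, level T v))"

definition compatible :: "'v rtree \<Rightarrow> 'v \<Rightarrow> 'v \<Rightarrow> bool" where
  "compatible T u v \<longleftrightarrow>
     (level T u < level T v \<and> label T u < label T v) \<or>
     (level T u > level T v \<and> label T u > label T v)"

definition inversion :: "'v rtree \<Rightarrow> 'v \<Rightarrow> 'v \<Rightarrow> bool" where
  "inversion T u v \<longleftrightarrow> u \<in> nonroot T \<and> v \<in> nonroot T \<and>
     descendant T v u \<and> compatible T v (parent T u) \<and>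
     (label T v < label T u \<or> (label T v = label T u \<and> level T v > level T u))"

definition tree_iso :: "'v rtree \<Rightarrow> 'w rtree \<Rightarrow> bool" where
  "tree_iso S T \<longleftrightarrow> (\<exists>f. bij_betw f (verts S) (verts T) \<and>
     (\<forall>u\<in>verts S. \<forall>v\<in>verts S. {u, v} \<in> edges S \<longleftrightarrow> {f u, f v} \<in> edges T) \<and>
     f (rt S) = rt T \<and>
     (\<forall>v\<in>verts S. label T (f v) = label S v \<and> level T (f v) = level S v))"

text \<open>Every finite tree is isomorphic to one whose vertices are natural numbers, so isomorphism
  classes of such trees represent all isomorphism classes.\<close>

definition RTT :: "nat \<Rightarrow> nat rtree set" where
  "RTT n = {T. tiered_rooted_tree T \<and> card (verts T) = n + 1}"

definition RTT_iso :: "nat \<Rightarrow> (nat rtree \<times> nat rtree) set" where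
  "RTT_iso n = {(S, T). S \<in> RTT n \<and> T \<in> RTT n \<and> tree_iso S T}"

lemma equiv_RTT_iso: "equiv (RTT n) (RTT_iso n)"
proof (rule equivI)
  show "RTT_iso n \<subseteq> RTT n \<times> RTT n"
    by (auto simp: RTT_iso_def)
  show "refl_on (RTT n) (RTT_iso n)"
    by (auto simp: refl_on_def RTT_iso_def tree_iso_def intro!: exI[of _ "\<lambda>x. x"] bij_betwI')
  have "tree_iso T S" if ST: "S \<in> RTT n" "tree_iso S T" for S T :: "nat rtree"
  proof -
    from ST(2) obtain f where f: "bij_betw f (verts S) (verts T)"
      "\<And>u v. u \<in> verts S \<Longrightarrow> v \<in> verts S \<Longrightarrow> {u, v} \<in> edges S \<longleftrightarrow> {f u, f v} \<in> edges T"
      "f (rt S) = rt T"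
      "\<And>v. v \<in> verts S \<Longrightarrow> label T (f v) = label S v \<and> level T (f v) = level S v"
      unfolding tree_iso_def by auto
    have r: "rt S \<in> verts S"
      using ST(1) by (simp add: RTT_def tiered_rooted_tree_def)
    define g where "g = inv_into (verts S) f"
    have g: "bij_betw g (verts T) (verts S)"
      unfolding g_def by (rule bij_betw_inv_into[OF f(1)])
    have gv: "g v \<in> verts S" "f (g v) = v" if "v \<in> verts T" for v
      using that g f(1) by (auto simp: g_def bij_betw_apply bij_betw_inv_into_right)
    have "g (rt T) = rt S"
      using r f(1,3) by (metis g_def bij_betw_inv_into_left)
    then show ?thesis
      unfolding tree_iso_def using g gv f(2,4) by (intro exI[of _ g]) (auto, (metis+)?)
  qed
  then show "sym (RTT_iso n)"
    by (auto simp: sym_def RTT_iso_def)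
  have "tree_iso S U" if "tree_iso S T" "tree_iso T U" for S T U :: "nat rtree"
  proof -
    from that obtain f g where fg: "bij_betw f (verts S) (verts T)" "bij_betw g (verts T) (verts U)"
      "\<forall>u\<in>verts S. \<forall>v\<in>verts S. {u, v} \<in> edges S \<longleftrightarrow> {f u, f v} \<in> edges T"
      "\<forall>u\<in>verts T. \<forall>v\<in>verts T. {u, v} \<in> edges T \<longleftrightarrow> {g u, g v} \<in> edges U"
      "f (rt S) = rt T" "g (rt T) = rt U"
      "\<forall>v\<in>verts S. label T (f v) = label S v \<and> level T (f v) = level S v"
      "\<forall>v\<in>verts T. label U (g v) = label T v \<and> level U (g v) = level T v"
      unfolding tree_iso_def by blast
    have "f v \<in> verts T" if "v \<in> verts S" for v
      using that fg(1) by (rule bij_betw_apply[rotated])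
    then show ?thesis
      unfolding tree_iso_def using fg bij_betw_trans[OF fg(1,2)]
      by (intro exI[of _ "g \<circ> f"]) auto
  qed
  then show "trans (RTT_iso n)"
    unfolding trans_def RTT_iso_def by blast
qed

definition zRTT0 :: "nat \<Rightarrow> nat rtree set set" where
  "zRTT0 n = {T \<in> RTT n. \<not> (\<exists>u v. inversion T u v)} // RTT_iso n"

text \<open>A weak composition is a function on the naturals that vanishes at 0; its entries are indexed
  from 1. Non-root labels and levels are positive, so the functions below do vanish at 0.\<close>

definition alpha_tree :: "'v rtree \<Rightarrow> nat \<Rightarrow> nat" where
  "alpha_tree T i = card {v \<in> nonroot T. label T v = i}"

definition beta_tree :: "'v rtree \<Rightarrow> nat \<Rightarrow> nat" where
  "beta_tree T i = card {v \<in> nonroot T. level T v = i}"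

definition zLD2 :: "nat \<Rightarrow> (nat list \<times> nat list) set" where
  "zLD2 n = {(a, b). length a = n \<and> length b = n \<and>
     (\<forall>x\<in>set a. x \<ge> 1) \<and> (\<forall>y\<in>set b. y \<ge> 1) \<and>
     (\<forall>i. Suc i < n \<longrightarrow> a ! i < a ! Suc i \<or> b ! i < b ! Suc i)}"

definition alpha_LD :: "nat list \<times> nat list \<Rightarrow> nat \<Rightarrow> nat" where
  "alpha_LD ab i = card {j. j < length (fst ab) \<and> fst ab ! j = i}"

definition beta_LD :: "nat list \<times> nat list \<Rightarrow> nat \<Rightarrow> nat" where
  "beta_LD ab i = card {j. j < length (snd ab) \<and> snd ab ! j = i}"

definition rev_comp :: "(nat \<Rightarrow> nat) \<Rightarrow> nat \<Rightarrow> nat" where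
  "rev_comp \<beta> i = (let s = Min {j. \<beta> j \<noteq> 0}; m = Max {j. \<beta> j \<noteq> 0}
     in if s \<le> i \<and> i \<le> m then \<beta> (s + m - i) else 0)"

end

theory Submission
  imports Defs "HOL-Library.Multiset" "HOL-Library.FuncSet"
begin

text \<open>
  Give a vertex the letter \<open>(label, level)\<close>, and order letters partially by
  \<open>p \<sqsubseteq> q \<longleftrightarrow> fst p \<le> fst q \<and> snd q \<le> snd p\<close>. Compatibility is incomparability for \<open>\<sqsubseteq>\<close>, and after
  reversing the levels a path of area zero is a word without a factor \<open>x y\<close> such that \<open>y \<sqsubseteq> x\<close>. Since
  \<open>\<sqsubseteq>\<close> is transitive, such words are normal forms for the traces (heaps) in which distinct comparable
  letters commute and no letter is stacked directly on an equal one.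

  Inversion-free forests below a vertex with letter \<open>p\<close> correspond to traces all of whose minimal
  elements are incomparable to \<open>p\<close>, because both decompose in the same way. Let \<open>c\<close> be the smallest
  letter incomparable to \<open>p\<close>, for the total order that defines inversions. In a forest, no inversion
  means that every \<open>c\<close> lies in the subtree of the child of \<open>p\<close> with letter \<open>c\<close>. In a trace, every \<open>c\<close>
  lies in the pyramid above the first \<open>c\<close>. Removing this part leaves an object of the same kind
  without \<open>c\<close>, and deleting the \<open>c\<close> at its base leaves an object of the same kind for \<open>c\<close> in place
  of \<open>p\<close>. Iterating gives a bijection that preserves the multiset of letters.
\<close>

section \<open>Words in normal form\<close>

text \<open>The order \<open>\<sqsubseteq>\<close> decides which letters commute; the total order
  \<open>\<preceq>\<close> selects the letter at which forests and words are split.\<close>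

locale ordered_alphabet =
  fixes le :: "'a \<Rightarrow> 'a \<Rightarrow> bool" (infix "\<sqsubseteq>" 50)
    and prec :: "'a \<Rightarrow> 'a \<Rightarrow> bool" (infix "\<preceq>" 50)
  assumes le_refl: "x \<sqsubseteq> x"
    and le_trans: "x \<sqsubseteq> y \<Longrightarrow> y \<sqsubseteq> z \<Longrightarrow> x \<sqsubseteq> z"
    and le_antisym: "x \<sqsubseteq> y \<Longrightarrow> y \<sqsubseteq> x \<Longrightarrow> x = y"
    and prec_trans: "x \<preceq> y \<Longrightarrow> y \<preceq> z \<Longrightarrow> x \<preceq> z"
    and prec_antisym: "x \<preceq> y \<Longrightarrow> y \<preceq> x \<Longrightarrow> x = y"
    and prec_total: "x \<preceq> y \<or> y \<preceq> x"
begin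

definition lt :: "'a \<Rightarrow> 'a \<Rightarrow> bool" (infix "\<sqsubset>" 50) where
  "x \<sqsubset> y \<longleftrightarrow> x \<sqsubseteq> y \<and> x \<noteq> y"

definition inc :: "'a \<Rightarrow> 'a \<Rightarrow> bool" where
  "inc x y \<longleftrightarrow> \<not> x \<sqsubseteq> y \<and> \<not> y \<sqsubseteq> x"

definition nf :: "'a list \<Rightarrow> bool" where
  "nf w \<longleftrightarrow> successively (\<lambda>x y. \<not> y \<sqsubseteq> x) w"

lemma nf_Nil [simp]: "nf []"
  by (simp add: nf_def)

lemma nf_Cons: "nf (x # w) \<longleftrightarrow> (w \<noteq> [] \<longrightarrow> \<not> hd w \<sqsubseteq> x) \<and> nf w"
  by (auto simp: nf_def successively_Cons)

text \<open>In terms of traces: all minimal elements satisfy \<open>N\<close>.\<close>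

fun supported :: "('a \<Rightarrow> bool) \<Rightarrow> 'a list \<Rightarrow> bool" where
  "supported N [] \<longleftrightarrow> True"
| "supported N (x # w) \<longleftrightarrow> N x \<and> supported (\<lambda>z. N z \<or> inc x z) w"

lemma supported_mono: "supported N w \<Longrightarrow> (\<And>x. N x \<Longrightarrow> N' x) \<Longrightarrow> supported N' w"
proof (induction w arbitrary: N N')
  case (Cons x w)
  from Cons.prems show ?case
    by (auto intro: Cons.IH[of "\<lambda>z. N z \<or> inc x z"])
qed simp

lemma supported_True: "supported (\<lambda>_. True) w"
  by (induction w) simp_all

section \<open>Splitting a word into two halves and merging them\<close>

text \<open>\<open>high (\<lambda>x. x \<noteq> c) w\<close> is the part of the trace of \<open>w\<close> above the first \<open>c\<close>, and \<open>low\<close> is the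
  rest. The predicate \<open>K\<close> holds for the letters that commute with all letters moved to \<open>high\<close> so
  far; in a normal form such a letter lies strictly above all of them in the partial order.\<close>

fun low :: "('a \<Rightarrow> bool) \<Rightarrow> 'a list \<Rightarrow> 'a list" where
  "low K [] = []"
| "low K (z # w) = (if K z then z # low K w else low (\<lambda>x. K x \<and> z \<sqsubset> x) w)"

fun high :: "('a \<Rightarrow> bool) \<Rightarrow> 'a list \<Rightarrow> 'a list" where
  "high K [] = []"
| "high K (z # w) = (if K z then high K w else z # high (\<lambda>x. K x \<and> z \<sqsubset> x) w)"

text \<open>Designed as the inverse of the splitting: in a normal form a letter moved to
  \<open>high\<close> precedes the remaining low letters exactly when it lies strictly below all of
  them.\<close>

fun merge :: "'a list \<Rightarrow> 'a list \<Rightarrow> 'a list" where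
  "merge [] v = v"
| "merge (x # u) [] = x # u"
| "merge (x # u) (y # v) =
     (if \<forall>z\<in>set (x # u). y \<sqsubset> z then y # merge (x # u) v else x # merge u (y # v))"

lemma merge_Nil2 [simp]: "merge u [] = u"
  by (cases u) simp_all

lemma mset_merge: "mset (merge u v) = mset u + mset v"
  by (induction u v rule: merge.induct) simp_all

lemma mset_low_high: "mset (low K w) + mset (high K w) = mset w"
  by (induction w arbitrary: K) auto

lemma low_subset: "x \<in> set (low K w) \<Longrightarrow> K x"
  by (induction w arbitrary: K) (auto split: if_splits)

text \<open>The letter just before the first high letter \<open>y\<close> is \<open>q\<close> or a
  low one, and by normality \<open>y\<close> is not below it. Hence \<open>merge\<close> does not
  take \<open>y\<close> before \<open>q\<close>.\<close>

lemma merge_low_high_Cons: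
  assumes "nf (q # w)"
  shows "merge (q # low K w) (high K w) = q # merge (low K w) (high K w)"
proof -
  have "\<exists>x\<in>set (q # low K w). \<not> y \<sqsubset> x" if "high K w = y # v" for y v
    using assms that
  proof (induction w arbitrary: q)
    case (Cons z w)
    show ?case
    proof (cases "K z")
      case True
      then show ?thesis
        using Cons.IH[of z] Cons.prems by (auto simp: nf_Cons)
    next
      case False
      then show ?thesis
        using Cons.prems by (auto simp: nf_Cons lt_def)
    qed
  qed simp
  then show ?thesis
    by (cases "high K w") auto
qed

text \<open>A letter moved to \<open>high\<close> lies strictly below all later low letters, so
  \<open>merge\<close> takes it next; a letter that stays low is taken next by
  \<open>merge_low_high_Cons\<close>.\<close>

lemma merge_low_high: "nf w \<Longrightarrow> merge (low K w) (high K w) = w"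
proof (induction w arbitrary: K)
  case (Cons z w)
  have nf: "nf w"
    using Cons.prems by (simp add: nf_Cons)
  show ?case
  proof (cases "K z")
    case True
    then show ?thesis
      using merge_low_high_Cons[OF Cons.prems, of K] Cons.IH[OF nf] by simp
  next
    case False
    let ?K = "\<lambda>x. K x \<and> z \<sqsubset> x"
    have "merge (low ?K w) (z # high ?K w) = z # merge (low ?K w) (high ?K w)"
      using low_subset[of _ ?K w] by (cases "low ?K w") auto
    then show ?thesis
      using False Cons.IH[OF nf] by simp
  qed
qed simp

text \<open>Removing \<open>z\<close> creates no bad pair: the low letters after \<open>z\<close>
  lie above \<open>z\<close>, so if one of them were below \<open>q\<close>, then \<open>z\<close>
  would be below \<open>q\<close> too.\<close>

lemma nf_Cons_low: "nf (q # w) \<Longrightarrow> nf (q # low K w)"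
proof (induction w arbitrary: q K)
  case (Cons z w)
  have zw: "nf (z # w)" and nle: "\<not> z \<sqsubseteq> q"
    using Cons.prems by (auto simp: nf_Cons)
  show ?case
  proof (cases "K z")
    case True
    then show ?thesis
      using Cons.IH[OF zw, of K] nle by (simp add: nf_Cons)
  next
    case False
    let ?K = "\<lambda>x. K x \<and> z \<sqsubset> x"
    have "\<not> hd (low ?K w) \<sqsubseteq> q" if "low ?K w \<noteq> []"
      using low_subset[of "hd (low ?K w)" ?K w] that nle le_trans by (auto simp: lt_def)
    then show ?thesis
      using False Cons.IH[OF zw, of ?K] by (simp add: nf_Cons)
  qed
qed simp

lemma nf_low: "nf w \<Longrightarrow> nf (low K w)"
proof (induction w arbitrary: K)
  case (Cons z w)
  then show ?case
    using nf_Cons_low[of z w] by (auto simp: nf_Cons)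
qed simp

text \<open>Here \<open>y\<close> is the letter last moved to \<open>high\<close> and
  \<open>q\<close> the letter last read. Letters kept low in between lie above \<open>y\<close>, so
  \<open>y \<sqsubseteq> q\<close> persists; the next high letter directly follows \<open>q\<close>,
  so it is not below \<open>q\<close> and hence not below \<open>y\<close>.\<close>

lemma nf_Cons_high:
  "\<lbrakk>nf (q # w); y \<sqsubseteq> q; \<And>x. K x \<Longrightarrow> y \<sqsubset> x\<rbrakk> \<Longrightarrow> nf (y # high K w)"
proof (induction w arbitrary: q y K)
  case (Cons z w)
  have zw: "nf (z # w)" and nle: "\<not> z \<sqsubseteq> q"
    using Cons.prems by (auto simp: nf_Cons)
  show ?case
  proof (cases "K z")
    case True
    then show ?thesis
      using Cons.IH[OF zw, of y K] Cons.prems(3) by (simp add: lt_def)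
  next
    case False
    have "\<not> z \<sqsubseteq> y"
      using nle Cons.prems(2) le_trans by blast
    then show ?thesis
      using False Cons.IH[OF zw le_refl, of "\<lambda>x. K x \<and> z \<sqsubset> x"] by (simp add: nf_Cons[of y])
  qed
qed (simp add: nf_Cons)

lemma nf_high: "nf w \<Longrightarrow> nf (high K w)"
proof (induction w arbitrary: K)
  case (Cons z w)
  then show ?case
    using nf_Cons_high[OF Cons.prems le_refl, of "\<lambda>x. K x \<and> z \<sqsubset> x"] by (auto simp: nf_Cons)
qed simp

text \<open>Low letters never rest on high ones: once \<open>z\<close> is moved, \<open>K\<close>
  keeps only letters above \<open>z\<close>, so the clause \<open>inc z\<close> added to
  \<open>N'\<close> admits no further low letter.\<close>

lemma supported_low:
  "\<lbrakk>supported N' w; \<And>x. K x \<Longrightarrow> N' x \<Longrightarrow> N x\<rbrakk> \<Longrightarrow> supported N (low K w)"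
proof (induction w arbitrary: N N' K)
  case (Cons z w)
  show ?case
  proof (cases "K z")
    case True
    have "supported (\<lambda>x. N x \<or> inc z x) (low K w)"
      by (rule Cons.IH[of "\<lambda>x. N' x \<or> inc z x"]) (use Cons.prems in auto)
    then show ?thesis
      using True Cons.prems by simp
  next
    case False
    have "supported N (low (\<lambda>x. K x \<and> z \<sqsubset> x) w)"
      by (rule Cons.IH[of "\<lambda>x. N' x \<or> inc z x"]) (use Cons.prems in \<open>auto simp: inc_def lt_def\<close>)
    then show ?thesis
      using False by simp
  qed
qed simp

text \<open>Here \<open>y\<close> is the letter most recently moved to \<open>high\<close>. The last premise is the invariant: a
  letter comparable to all letters moved so far, but not above all of them, is already below the
  latest one, so that it cannot come next in a normal form.\<close>

lemma supported_high:
  "\<lbrakk>nf (q # w); y \<sqsubseteq> q; \<And>x. K x \<Longrightarrow> y \<sqsubset> x; \<And>x. K x \<or> N x \<or> x \<sqsubseteq> y\<rbrakk>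
    \<Longrightarrow> supported N (high K w)"
proof (induction w arbitrary: q y K N)
  case (Cons z w)
  have zw: "nf (z # w)" and nle: "\<not> z \<sqsubseteq> q"
    using Cons.prems by (auto simp: nf_Cons)
  show ?case
  proof (cases "K z")
    case True
    then show ?thesis
      using Cons.IH[OF zw, of y K N] Cons.prems(3,4) by (simp add: lt_def)
  next
    case False
    have nle': "\<not> z \<sqsubseteq> y"
      using nle Cons.prems(2) le_trans by blast
    have "supported (\<lambda>x. N x \<or> inc z x) (high (\<lambda>x. K x \<and> z \<sqsubset> x) w)"
    proof (rule Cons.IH[OF zw le_refl])
      show "(K x \<and> z \<sqsubset> x) \<or> (N x \<or> inc z x) \<or> x \<sqsubseteq> z" for x
        using Cons.prems(4)[of x] nle' le_trans[of z x y] by (auto simp: lt_def inc_def le_refl)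
    qed simp
    then show ?thesis
      using False Cons.prems(4)[of z] nle' by simp
  qed
qed simp

text \<open>The first letter moved is the first \<open>c\<close>. The invariant of
  \<open>supported_high\<close> then holds for \<open>inc c\<close>, because every letter is above
  \<open>c\<close>, incomparable to it, or below it.\<close>

lemma high_first:
  "\<lbrakk>nf w; c \<in> set w\<rbrakk> \<Longrightarrow> \<exists>v. high (\<lambda>x. x \<noteq> c) w = c # v \<and> supported (inc c) v"
proof (induction w)
  case (Cons z w)
  show ?case
  proof (cases "z = c")
    case True
    have "supported (inc c) (high (\<lambda>x. x \<noteq> c \<and> c \<sqsubset> x) w)"
      by (rule supported_high[where q = c and y = c])
        (use Cons.prems True in \<open>auto simp: lt_def inc_def le_refl\<close>)
    then show ?thesis
      using True by simp
  next
    case False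
    then show ?thesis
      using Cons by (simp add: nf_Cons)
  qed
qed simp

section \<open>Recovering the two halves of a merge\<close>

fun blocked :: "('a \<Rightarrow> bool) \<Rightarrow> 'a list \<Rightarrow> bool" where
  "blocked K [] \<longleftrightarrow> True"
| "blocked K (y # v) \<longleftrightarrow> \<not> K y \<and> blocked (\<lambda>x. K x \<and> y \<sqsubset> x) v"

text \<open>\<open>blocked K v\<close> means that splitting at \<open>K\<close> moves all of
  \<open>v\<close> to \<open>high\<close>. A supported letter satisfies \<open>N\<close>, hence
  fails \<open>K\<close>, or is incomparable to an earlier letter, hence not above it.\<close>

lemma supported_imp_blocked:
  "\<lbrakk>supported N v; \<And>x. N x \<Longrightarrow> \<not> K x\<rbrakk> \<Longrightarrow> blocked K v"
proof (induction v arbitrary: N K)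
  case (Cons y v)
  have "blocked (\<lambda>x. K x \<and> y \<sqsubset> x) v"
    by (rule Cons.IH[of "\<lambda>z. N z \<or> inc y z"]) (use Cons.prems in \<open>auto simp: lt_def inc_def\<close>)
  then show ?case
    using Cons.prems by auto
qed simp

lemma blocked_Cons_supported: "supported (inc c) v \<Longrightarrow> blocked (\<lambda>x. x \<noteq> c) (c # v)"
  using supported_imp_blocked[of "inc c" v "\<lambda>x. x \<noteq> c \<and> c \<sqsubset> x"] by (auto simp: lt_def inc_def)

lemma low_all [simp]: "\<forall>x\<in>set u. K x \<Longrightarrow> low K u = u"
  by (induction u) simp_all

lemma high_all [simp]: "\<forall>x\<in>set u. K x \<Longrightarrow> high K u = []"
  by (induction u) simp_all

lemma low_blocked: "blocked K v \<Longrightarrow> low K v = []"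
  by (induction v arbitrary: K) simp_all

lemma high_blocked: "blocked K v \<Longrightarrow> high K v = v"
  by (induction v arbitrary: K) simp_all

text \<open>When \<open>merge\<close> takes \<open>y\<close>, the rest of \<open>u\<close> lies
  above \<open>y\<close>, so it satisfies the narrowed predicate and stays low. Taking a letter of
  \<open>u\<close> leaves the predicate unchanged.\<close>

lemma low_high_merge:
  "\<lbrakk>\<forall>x\<in>set u. K x; blocked K v\<rbrakk> \<Longrightarrow> low K (merge u v) = u \<and> high K (merge u v) = v"
proof (induction u v arbitrary: K rule: merge.induct)
  case (3 x u y v)
  show ?case
  proof (cases "\<forall>z\<in>set (x # u). y \<sqsubset> z")
    case True
    have "low (\<lambda>z. K z \<and> y \<sqsubset> z) (merge (x # u) v) = x # u \<and>
        high (\<lambda>z. K z \<and> y \<sqsubset> z) (merge (x # u) v) = v"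
      by (rule "3.IH"(1)) (use True "3.prems" in auto)
    then show ?thesis
      using True "3.prems" by simp
  next
    case False
    have "low K (merge u (y # v)) = u \<and> high K (merge u (y # v)) = y # v"
      by (rule "3.IH"(2)) (use False "3.prems" in auto)
    then show ?thesis
      using False "3.prems" by auto
  qed
qed (auto simp: low_blocked high_blocked)

lemma nf_merge:
  "\<lbrakk>nf u; nf v; \<forall>x\<in>set u. K x; blocked K v\<rbrakk> \<Longrightarrow> nf (merge u v)"
proof (induction u v arbitrary: K rule: merge.induct)
  case (3 x u y v)
  show ?case
  proof (cases "\<forall>z\<in>set (x # u). y \<sqsubset> z")
    case True
    have "nf (merge (x # u) v)"
      by (rule "3.IH"(1)[where K = "\<lambda>z. K z \<and> y \<sqsubset> z"])
        (use True "3.prems" in \<open>auto simp: nf_Cons\<close>)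
    moreover have "hd (merge (x # u) v) = x \<or> (v \<noteq> [] \<and> hd (merge (x # u) v) = hd v)"
      by (cases v) auto
    ultimately show ?thesis
      using True "3.prems"(2) le_antisym by (auto simp: nf_Cons[of y] lt_def)
  next
    case False
    have nf: "nf (merge u (y # v))"
      by (rule "3.IH"(2)[where K = K]) (use False "3.prems" in \<open>auto simp: nf_Cons\<close>)
    have "\<not> hd (merge u (y # v)) \<sqsubseteq> x"
    proof (cases "\<forall>z\<in>set u. y \<sqsubset> z")
      case True
      \<comment> \<open>\<open>y\<close> is not strictly below \<open>x\<close>, and
        \<open>y \<noteq> x\<close> because \<open>K\<close> holds for \<open>x\<close> and fails
        for \<open>y\<close>.\<close>
      then have "\<not> y \<sqsubseteq> x"
        using False "3.prems"(3,4) by (auto simp: lt_def)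
      then show ?thesis
        using True by (cases u) auto
    next
      case False
      then show ?thesis
        using "3.prems"(1) by (cases u) (auto simp: nf_Cons)
    qed
    then show ?thesis
      using nf False by (auto simp: nf_Cons[of x])
  qed
qed auto

lemma supported_merge: "\<lbrakk>supported N u; supported N v\<rbrakk> \<Longrightarrow> supported N (merge u v)"
proof (induction u v arbitrary: N rule: merge.induct)
  case (3 x u y v)
  show ?case
  proof (cases "\<forall>z\<in>set (x # u). y \<sqsubset> z")
    case True
    have "supported (\<lambda>z. N z \<or> inc y z) (merge (x # u) v)"
    proof (rule "3.IH"(1)[OF True])
      show "supported (\<lambda>z. N z \<or> inc y z) (x # u)"
        using "3.prems"(1) by (rule supported_mono) simp
    qed (use "3.prems" in simp)
    then show ?thesis
      using True "3.prems" by simp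
  next
    case False
    have "supported (\<lambda>z. N z \<or> inc x z) (merge u (y # v))"
    proof (rule "3.IH"(2)[OF False])
      show "supported (\<lambda>z. N z \<or> inc x z) (y # v)"
        using "3.prems"(2) by (rule supported_mono) simp
    qed (use "3.prems" in simp)
    then show ?thesis
      using False "3.prems" by auto
  qed
qed auto

section \<open>Decomposition of words at a letter\<close>

definition words :: "('a \<Rightarrow> bool) \<Rightarrow> 'a multiset \<Rightarrow> 'a list set" where
  "words N M = {w. nf w \<and> supported N w \<and> mset w = M}"

lemma words_empty: "words N {#} = {[]}"
  by (auto simp: words_def)

lemma words_no_start: "\<lbrakk>M \<noteq> {#}; \<forall>x\<in>#M. \<not> N x\<rbrakk> \<Longrightarrow> words N M = {}"
proof -
  assume "M \<noteq> {#}" "\<forall>x\<in>#M. \<not> N x"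
  then have False if "w \<in> words N M" for w
    using that by (cases w) (auto simp: words_def)
  then show ?thesis
    by blast
qed

text \<open>\<open>v\<close> is the pyramid over the first \<open>c\<close> without its base, and
  \<open>u\<close> is what remains when that pyramid is removed.\<close>

definition word_pairs :: "('a \<Rightarrow> bool) \<Rightarrow> 'a multiset \<Rightarrow> 'a \<Rightarrow> ('a list \<times> 'a list) set" where
  "word_pairs N M c = {(u, v). nf u \<and> supported N u \<and> nf v \<and> supported (inc c) v \<and>
     c \<notin> set u \<and> add_mset c (mset u + mset v) = M}"

lemma bij_betw_words:
  assumes "c \<in># M" "N c"
  shows "bij_betw (\<lambda>(u, v). merge u (c # v)) (word_pairs N M c) (words N M)"
proof (rule bij_betwI[where g = "\<lambda>w. (low (\<lambda>x. x \<noteq> c) w, tl (high (\<lambda>x. x \<noteq> c) w))"])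
  show "(\<lambda>(u, v). merge u (c # v)) \<in> word_pairs N M c \<rightarrow> words N M"
  proof (clarsimp simp: word_pairs_def words_def, intro conjI)
    fix u v
    assume *: "nf u" "supported N u" "nf v" "supported (inc c) v" "c \<notin> set u"
    have "nf (c # v)"
      using *(3,4) by (cases v) (auto simp: nf_Cons inc_def)
    then show "nf (merge u (c # v))"
      using nf_merge[OF *(1) _ _ blocked_Cons_supported[OF *(4)]] *(5) by blast
    have "supported N (c # v)"
      using *(4) assms(2) by (auto elim: supported_mono)
    then show "supported N (merge u (c # v))"
      by (rule supported_merge[OF *(2)])
    show "mset (merge u (c # v)) = add_mset c (mset u + mset v)"
      by (simp add: mset_merge)
  qed
  show "(\<lambda>w. (low (\<lambda>x. x \<noteq> c) w, tl (high (\<lambda>x. x \<noteq> c) w))) \<in> words N M \<rightarrow> word_pairs N M c"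
  proof
    fix w
    assume "w \<in> words N M"
    then have w: "nf w" "supported N w" "mset w = M"
      by (auto simp: words_def)
    obtain v where v: "high (\<lambda>x. x \<noteq> c) w = c # v" "supported (inc c) v"
      using high_first[OF w(1), of c] assms(1) w(3) by auto
    have "add_mset c (mset (low (\<lambda>x. x \<noteq> c) w) + mset v) = M"
      using mset_low_high[of "\<lambda>x. x \<noteq> c" w] v w by simp
    then show "(low (\<lambda>x. x \<noteq> c) w, tl (high (\<lambda>x. x \<noteq> c) w)) \<in> word_pairs N M c"
      using v nf_low[OF w(1)] nf_high[OF w(1), of "\<lambda>x. x \<noteq> c"]
        supported_low[OF w(2), of "\<lambda>x. x \<noteq> c" N] low_subset[of c "\<lambda>x. x \<noteq> c" w]
      by (auto simp: word_pairs_def nf_Cons)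
  qed
next
  fix p
  assume "p \<in> word_pairs N M c"
  then obtain u v where p: "p = (u, v)" and uv: "supported (inc c) v" "c \<notin> set u"
    by (auto simp: word_pairs_def)
  have "\<forall>x\<in>set u. x \<noteq> c"
    using uv(2) by auto
  from low_high_merge[OF this blocked_Cons_supported[OF uv(1)]] p
  show "(low (\<lambda>x. x \<noteq> c) ((\<lambda>(u, v). merge u (c # v)) p),
      tl (high (\<lambda>x. x \<noteq> c) ((\<lambda>(u, v). merge u (c # v)) p))) = p"
    by simp
next
  fix w
  assume "w \<in> words N M"
  then have w: "nf w" "c \<in> set w"
    using assms(1) by (auto simp: words_def)
  obtain v where "high (\<lambda>x. x \<noteq> c) w = c # v"
    using high_first[OF w] by auto
  then show "(\<lambda>(u, v). merge u (c # v)) (low (\<lambda>x. x \<noteq> c) w, tl (high (\<lambda>x. x \<noteq> c) w)) = w"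
    using merge_low_high[OF w(1), of "\<lambda>x. x \<noteq> c"] by simp
qed

end

section \<open>Inversion-free tries\<close>

text \<open>Siblings carry different letters, so a tree is determined up to isomorphism by the set of
  letter sequences read along the paths from its root.\<close>

definition trie :: "'a list set \<Rightarrow> bool" where
  "trie A \<longleftrightarrow> finite A \<and> [] \<in> A \<and> (\<forall>x a. x @ [a] \<in> A \<longrightarrow> x \<in> A)"

lemma trieD_prefix: "trie A \<Longrightarrow> x @ y \<in> A \<Longrightarrow> x \<in> A"
proof (induction y rule: rev_induct)
  case (snoc b y)
  then show ?case
    unfolding trie_def by (metis append_assoc)
qed simp

text \<open>A nonempty sequence stands for a nonroot vertex, whose own letter is the last
  one.\<close>

definition content :: "'a list set \<Rightarrow> 'a multiset" where
  "content A = image_mset last (mset_set (A - {[]}))"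

lemma in_content_iff: "trie A \<Longrightarrow> c \<in># content A \<longleftrightarrow> (\<exists>x\<in>A. x \<noteq> [] \<and> last x = c)"
  by (auto simp: content_def trie_def)

lemma snoc_in_content: "trie A \<Longrightarrow> x @ [c] \<in> A \<Longrightarrow> c \<in># content A"
  by (metis in_content_iff last_snoc snoc_eq_iff_butlast)

lemma size_content: "trie A \<Longrightarrow> size (content A) = card A - 1"
  by (simp add: content_def trie_def card_Diff_singleton)

lemma content_eq_empty: "trie A \<Longrightarrow> content A = {#} \<longleftrightarrow> A = {[]}"
  by (auto simp: content_def trie_def mset_set_empty_iff)

text \<open>Grafting hangs \<open>B\<close> below a new child \<open>c\<close> of the root.
  Prefixing with \<open>c\<close> keeps the last letter of a nonempty sequence, while the root of
  \<open>B\<close> becomes the vertex \<open>[c]\<close> and supplies the extra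
  \<open>c\<close>.\<close>

lemma content_graft:
  assumes A: "finite A" "\<And>x. c # x \<notin> A" and B: "finite B" "[] \<in> B"
  shows "content (A \<union> (#) c ` B) = add_mset c (content A + content B)"
proof -
  have "A \<union> (#) c ` B - {[]} = (A - {[]}) \<union> ((#) c ` (B - {[]}) \<union> {[c]})"
    using B(2) by auto
  moreover have "(A - {[]}) \<inter> ((#) c ` (B - {[]}) \<union> {[c]}) = {}"
    using A(2) by auto
  moreover have "mset_set ((#) c ` (B - {[]}) \<union> {[c]}) = mset_set ((#) c ` (B - {[]})) + {#[c]#}"
    using B(1) by (subst mset_set_Union) auto
  ultimately have "mset_set (A \<union> (#) c ` B - {[]}) =
      mset_set (A - {[]}) + (mset_set ((#) c ` (B - {[]})) + {#[c]#})"
    using A(1) B(1) mset_set_Union[of "A - {[]}" "(#) c ` (B - {[]}) \<union> {[c]}"] by simp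
  moreover have "mset_set ((#) c ` (B - {[]})) = image_mset ((#) c) (mset_set (B - {[]}))"
    by (simp add: image_mset_mset_set)
  moreover have "image_mset (last \<circ> (#) c) (mset_set (B - {[]})) = content B"
    unfolding content_def by (rule image_mset_cong) (use B(1) in auto)
  ultimately show ?thesis
    by (simp add: content_def multiset.map_comp)
qed

section \<open>Inversion-free forests and their decomposition\<close>

context ordered_alphabet
begin

text \<open>The letters admissible below the vertex \<open>x\<close>. Leaving \<open>N\<close> open
  at the root makes the subtree at a child with letter \<open>c\<close> a forest again, for
  \<open>inc c\<close>.\<close>

definition start :: "('a \<Rightarrow> bool) \<Rightarrow> 'a list \<Rightarrow> 'a \<Rightarrow> bool" where
  "start N x = (if x = [] then N else inc (last x))"

lemma start_Nil [simp]: "start N [] = N"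
  by (simp add: start_def)

lemma start_Cons [simp]: "start N (c # x) = start (inc c) x"
  by (simp add: start_def)

text \<open>The last clause excludes inversions: \<open>x @ [a]\<close> is the upper vertex,
  \<open>x\<close> its parent, and \<open>x @ a # y @ [b]\<close> a descendant compatible with
  \<open>x\<close>.\<close>

definition forest :: "('a \<Rightarrow> bool) \<Rightarrow> 'a list set \<Rightarrow> bool" where
  "forest N A \<longleftrightarrow> trie A \<and> (\<forall>x a. x @ [a] \<in> A \<longrightarrow> start N x a) \<and>
     (\<forall>x a y b. x @ a # y @ [b] \<in> A \<longrightarrow> start N x b \<longrightarrow> a \<preceq> b)"

definition forests :: "('a \<Rightarrow> bool) \<Rightarrow> 'a multiset \<Rightarrow> 'a list set set" where
  "forests N M = {A. forest N A \<and> content A = M}"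

lemma forest_single: "forest N {[]}"
  by (simp add: forest_def trie_def)

lemma forest_imp_trie: "forest N A \<Longrightarrow> trie A"
  by (simp add: forest_def)

lemma forests_empty: "forests N {#} = {{[]}}"
  using content_eq_empty[OF forest_imp_trie] forest_single[of N]
  unfolding forests_def by blast

lemma forests_no_start: "\<lbrakk>M \<noteq> {#}; \<forall>x\<in>#M. \<not> N x\<rbrakk> \<Longrightarrow> forests N M = {}"
proof -
  assume M: "M \<noteq> {#}" "\<forall>x\<in>#M. \<not> N x"
  have False if "A \<in> forests N M" for A
  proof -
    have A: "forest N A" "content A = M" "trie A"
      using that by (auto simp: forests_def forest_def)
    then obtain x where "x \<in> A" "x \<noteq> []"
      using M(1) content_eq_empty[OF A(3)] by (auto simp: trie_def)
    then obtain a y where "[a] @ y \<in> A"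
      by (cases x) auto
    then have a: "[a] \<in> A"
      using trieD_prefix[OF A(3)] by blast
    then have "a \<in># M"
      using A(2,3) snoc_in_content[of A "[]" a] by simp
    moreover have "N a"
      using a A(1) unfolding forest_def by (metis append_Nil start_Nil)
    ultimately show False
      using M(2) by blast
  qed
  then show ?thesis
    by blast
qed

definition forest_pairs ::
  "('a \<Rightarrow> bool) \<Rightarrow> 'a multiset \<Rightarrow> 'a \<Rightarrow> ('a list set \<times> 'a list set) set" where
  "forest_pairs N M c = {(A, B). forest N A \<and> forest (inc c) B \<and> c \<notin># content A \<and>
     add_mset c (content A + content B) = M}"

lemma not_in_content_imp: "trie A \<Longrightarrow> c \<notin># content A \<Longrightarrow> c # x \<notin> A"
proof
  assume A: "trie A" "c \<notin># content A" "c # x \<in> A"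
  then have "[c] \<in> A"
    using trieD_prefix[of A "[c]" x] by simp
  then show False
    using A(1,2) snoc_in_content[of A "[]" c] by simp
qed

lemma forest_graft:
  assumes A: "forest N A" "c \<notin># content A" and B: "forest (inc c) B"
    and c: "N c" "\<And>b. b \<in># content B \<Longrightarrow> N b \<Longrightarrow> c \<preceq> b"
  shows "forest N (A \<union> (#) c ` B)"
  unfolding forest_def
proof (intro conjI allI impI)
  have tA: "trie A" and tB: "trie B"
    using A(1) B by (auto simp: forest_def)
  show "trie (A \<union> (#) c ` B)"
    unfolding trie_def
  proof (intro conjI allI impI)
    fix x a
    assume xa: "x @ [a] \<in> A \<union> (#) c ` B"
    show "x \<in> A \<union> (#) c ` B"
    proof (cases "x @ [a] \<in> A")
      case True
      then show ?thesis
        using tA unfolding trie_def by blast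
    next
      case False
      then show ?thesis
        using xa tA tB by (cases x) (auto simp: trie_def)
    qed
  qed (use tA tB in \<open>auto simp: trie_def\<close>)
  fix x a
  show "start N x a" if xa: "x @ [a] \<in> A \<union> (#) c ` B"
  proof (cases "x @ [a] \<in> A")
    case True
    then show ?thesis
      using A(1) unfolding forest_def by blast
  next
    case False
    then show ?thesis
      using xa B c(1) by (cases x) (auto simp: forest_def)
  qed
  fix y b
  assume *: "x @ a # y @ [b] \<in> A \<union> (#) c ` B" "start N x b"
  show "a \<preceq> b"
  proof (cases "x @ a # y @ [b] \<in> A")
    case True
    then show ?thesis
      using A(1) *(2) by (auto simp: forest_def)
  next
    case False
    then obtain z where z: "z \<in> B" "x @ a # y @ [b] = c # z"
      using *(1) by auto
    show ?thesis
    proof (cases x)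
      case Nil
      then have "a = c" "z = y @ [b]"
        using z(2) by auto
      moreover have "b \<in># content B"
        using z(1) \<open>z = y @ [b]\<close> snoc_in_content[OF tB, of y b] by simp
      ultimately show ?thesis
        using c(2) *(2) Nil by simp
    next
      case (Cons d x')
      then show ?thesis
        using z B *(2) by (auto simp: forest_def)
    qed
  qed
qed

text \<open>Let \<open>a\<close> be the letter of the child of the root on the way to
  \<open>x\<close>. Since \<open>c\<close> is admissible at the root, the absence of inversions
  gives \<open>a \<preceq> c\<close>, and minimality of \<open>c\<close> gives
  \<open>c \<preceq> a\<close>.\<close>

lemma forest_first_letter:
  assumes D: "forest N D" and c: "N c" "\<And>b. b \<in># content D \<Longrightarrow> N b \<Longrightarrow> c \<preceq> b"
    and x: "x \<in> D" "x \<noteq> []" "last x = c"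
  shows "hd x = c"
proof -
  have tD: "trie D"
    using D by (simp add: forest_def)
  obtain a y where xa: "x = a # y"
    using x(2) by (cases x) auto
  have a: "[a] \<in> D"
    using trieD_prefix[OF tD, of "[a]" y] x(1) xa by simp
  have "N a"
    using D a unfolding forest_def by (metis append_Nil start_Nil)
  moreover have "a \<in># content D"
    using a tD snoc_in_content[of D "[]" a] by simp
  ultimately have ca: "c \<preceq> a"
    using c(2) by blast
  have "a = c"
  proof (cases y rule: rev_cases)
    case (snoc y' b)
    then have b: "b = c" and "[] @ a # y' @ [b] \<in> D"
      using x xa by auto
    then have "a \<preceq> b"
      using D c(1) unfolding forest_def by (metis start_Nil)
    then show ?thesis
      using b ca prec_antisym by blast
  qed (use xa x(3) in auto)
  then show ?thesis
    using xa by simp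
qed

lemma bij_betw_forests:
  assumes c: "c \<in># M" "N c" "\<And>b. b \<in># M \<Longrightarrow> N b \<Longrightarrow> c \<preceq> b"
  shows "bij_betw (\<lambda>(A, B). A \<union> (#) c ` B) (forest_pairs N M c) (forests N M)"
proof (rule bij_betwI[where g = "\<lambda>D. ({x \<in> D. x = [] \<or> hd x \<noteq> c}, {y. c # y \<in> D})"])
  show "(\<lambda>(A, B). A \<union> (#) c ` B) \<in> forest_pairs N M c \<rightarrow> forests N M"
  proof (clarsimp simp: forest_pairs_def forests_def, intro conjI)
    fix A B
    assume *: "forest N A" "forest (inc c) B" "c \<notin># content A"
      and M: "M = add_mset c (content A + content B)"
    show "forest N (A \<union> (#) c ` B)"
      by (rule forest_graft) (use * c M in auto)
    show "content (A \<union> (#) c ` B) = add_mset c (content A + content B)"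
      by (rule content_graft)
        (use * not_in_content_imp[of A c] in \<open>auto simp: forest_def trie_def\<close>)
  qed
  show "(\<lambda>D. ({x \<in> D. x = [] \<or> hd x \<noteq> c}, {y. c # y \<in> D})) \<in> forests N M \<rightarrow> forest_pairs N M c"
  proof
    fix D
    assume "D \<in> forests N M"
    then have D: "forest N D" "content D = M" and tD: "trie D"
      by (auto simp: forests_def forest_def)
    let ?A = "{x \<in> D. x = [] \<or> hd x \<noteq> c}" and ?B = "{y. c # y \<in> D}"
    have first: "hd x = c" if "x \<in> D" "x \<noteq> []" "last x = c" for x
      by (rule forest_first_letter[OF D(1)]) (use c D(2) that in auto)
    have tA: "trie ?A"
      unfolding trie_def
    proof (intro conjI allI impI)
      fix x a
      assume xa: "x @ [a] \<in> ?A"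
      then have "x \<in> D"
        using tD unfolding trie_def by blast
      then show "x \<in> ?A"
        using xa by (cases x) auto
    qed (use tD in \<open>auto simp: trie_def\<close>)
    then have fA: "forest N ?A"
      using D(1) unfolding forest_def by blast
    have cA: "c \<notin># content ?A"
      using first by (auto simp: in_content_iff[OF tA])
    have finB: "finite ?B"
      using finite_vimageI[of D "(#) c"] tD by (simp add: trie_def vimage_def)
    \<comment> \<open>As \<open>c\<close> occurs in \<open>M\<close>, some vertex carries it. The
      sequence of that vertex starts with \<open>c\<close>, so the child \<open>[c]\<close> exists
      and \<open>[]\<close> lies in \<open>?B\<close>.\<close>
    obtain x where x: "x \<in> D" "x \<noteq> []" "last x = c"
      using c(1) D(2) in_content_iff[OF tD] by auto
    then have "[c] @ tl x \<in> D"
      using first[of x] by (cases x) auto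
    then have B: "[] \<in> ?B"
      using trieD_prefix[OF tD] by blast
    have fB: "forest (inc c) ?B"
      unfolding forest_def
    proof (intro conjI allI impI)
      show "trie ?B"
        using tD finB B unfolding trie_def by (metis append_Cons mem_Collect_eq)
      fix x a
      show "start (inc c) x a" if "x @ [a] \<in> ?B"
        using D(1) that unfolding forest_def by (metis append_Cons mem_Collect_eq start_Cons)
      fix y b
      show "a \<preceq> b" if "x @ a # y @ [b] \<in> ?B" "start (inc c) x b"
        using D(1) that unfolding forest_def by (metis append_Cons mem_Collect_eq start_Cons)
    qed
    have "content (?A \<union> (#) c ` ?B) = add_mset c (content ?A + content ?B)"
      by (rule content_graft) (use tA finB B in \<open>auto simp: trie_def\<close>)
    moreover have "?A \<union> (#) c ` ?B = D"
      by (auto simp: image_iff) (metis list.collapse)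
    ultimately show "(?A, ?B) \<in> forest_pairs N M c"
      using fA fB cA D(2) by (simp add: forest_pairs_def)
  qed
next
  fix p
  assume "p \<in> forest_pairs N M c"
  then obtain A B where p: "p = (A, B)" and AB: "trie A" "c \<notin># content A"
    by (auto simp: forest_pairs_def forest_def)
  have "c # x \<notin> A" for x
    using not_in_content_imp[OF AB] .
  moreover from this have "x = [] \<or> hd x \<noteq> c" if "x \<in> A" for x
    using that by (cases x) auto
  ultimately have "{x \<in> A \<union> (#) c ` B. x = [] \<or> hd x \<noteq> c} = A" "{y. c # y \<in> A \<union> (#) c ` B} = B"
    by auto
  then show "({x \<in> (\<lambda>(A, B). A \<union> (#) c ` B) p. x = [] \<or> hd x \<noteq> c},
      {y. c # y \<in> (\<lambda>(A, B). A \<union> (#) c ` B) p}) = p"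
    using p by simp
next
  fix D
  show "(\<lambda>(A, B). A \<union> (#) c ` B) ({x \<in> D. x = [] \<or> hd x \<noteq> c}, {y. c # y \<in> D}) = D"
    by (auto simp: image_iff) (metis list.collapse)
qed

section \<open>The bijection by recursion on the multiset of letters\<close>

lemma ex_prec_least: "finite S \<Longrightarrow> S \<noteq> {} \<Longrightarrow> \<exists>c\<in>S. \<forall>b\<in>S. c \<preceq> b"
proof (induction S rule: finite_ne_induct)
  case (singleton x)
  then show ?case
    using prec_total by blast
next
  case (insert x S)
  then obtain c where "c \<in> S" "\<forall>b\<in>S. c \<preceq> b"
    by blast
  then show ?case
    using prec_total[of x c] prec_total[of x x] prec_trans by blast
qed

text \<open>Fixing the multiset preserves the letters by construction and provides the induction
  measure. \<open>N\<close> varies because the part above \<open>c\<close> is an object for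
  \<open>inc c\<close>.\<close>

lemma ex_bij_betw_forests_words: "\<exists>f. bij_betw f (forests N M) (words N M)"
proof (induction "size M" arbitrary: N M rule: less_induct)
  case less
  consider "M = {#}" | "M \<noteq> {#}" "\<forall>x\<in>#M. \<not> N x" | "{x \<in> set_mset M. N x} \<noteq> {}"
    by blast
  then show ?case
  proof cases
    case 1
    have "bij_betw (\<lambda>_. []) {{[]}} {[]}"
      by (simp add: bij_betw_def)
    then show ?thesis
      using 1 by (auto simp: forests_empty words_empty)
  next
    case 2
    then show ?thesis
      by (auto simp: forests_no_start words_no_start bij_betw_def)
  next
    case 3
    then obtain c where c: "c \<in># M" "N c" "\<And>b. b \<in># M \<Longrightarrow> N b \<Longrightarrow> c \<preceq> b"
      using ex_prec_least[of "{x \<in> set_mset M. N x}"] by auto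
    \<comment> \<open>A choice depending on \<open>N\<close> and \<open>M\<close> alone; it is a
      bijection at every smaller multiset by the induction hypothesis.\<close>
    define f where "f N M = (SOME f. bij_betw f (forests N M) (words N M))" for N M
    have f: "bij_betw (f N' M') (forests N' M') (words N' M')" if "size M' < size M" for N' M'
      unfolding f_def using someI_ex[OF less[OF that]] .
    have mset_f: "f N' (content A) A \<in> words N' (content A)"
      if "forest N' A" "size (content A) < size M" for N' A
      using bij_betwE[OF f[OF that(2)]] that(1) by (simp add: forests_def)
    \<comment> \<open>The multiset indexing \<open>f\<close> can be read off from the resulting
      word, so injectivity holds across different multisets.\<close>
    have inj_f: "A = A'"
      if "forest N' A" "size (content A) < size M" "forest N' A'" "size (content A') < size M"
        "f N' (content A) A = f N' (content A') A'" for N' A A'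
    proof -
      have eq: "content A = content A'"
        using mset_f[OF that(1,2)] mset_f[OF that(3,4)] that(5) by (simp add: words_def)
      show ?thesis
        using bij_betw_imp_inj_on[OF f[OF that(2), of N']] that eq
        by (auto simp: inj_on_def forests_def)
    qed
    have surj_f: "\<exists>A. forest N' A \<and> content A = mset w \<and> f N' (mset w) A = w"
      if "nf w" "supported N' w" "size (mset w) < size M" for N' w
    proof -
      have "w \<in> f N' (mset w) ` forests N' (mset w)"
        using bij_betw_imp_surj_on[OF f[OF that(3), of N']] that by (simp add: words_def)
      then show ?thesis
        by (auto simp: forests_def)
    qed
    let ?h = "\<lambda>(A, B). (f N (content A) A, f (inc c) (content B) B)"
    have size1: "size P < size M" "size Q < size M" if "add_mset c (P + Q) = M" for P Q
      using that by auto
    have "bij_betw ?h (forest_pairs N M c) (word_pairs N M c)"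
      unfolding bij_betw_def
    proof (intro conjI set_eqI iffI)
      show "inj_on ?h (forest_pairs N M c)"
      proof (rule inj_onI, clarify)
        fix A B A' B'
        assume "(A, B) \<in> forest_pairs N M c" "(A', B') \<in> forest_pairs N M c"
          "f N (content A) A = f N (content A') A'"
          "f (inc c) (content B) B = f (inc c) (content B') B'"
        then show "A = A' \<and> B = B'"
          using inj_f size1 unfolding forest_pairs_def by blast
      qed
    next
      fix p
      assume "p \<in> ?h ` forest_pairs N M c"
      then obtain A B where p: "p = ?h (A, B)" and AB: "(A, B) \<in> forest_pairs N M c"
        by auto
      then have M: "add_mset c (content A + content B) = M"
        by (simp add: forest_pairs_def)
      show "p \<in> word_pairs N M c"
        using p AB mset_f[OF _ size1(1)[OF M], of N] mset_f[OF _ size1(2)[OF M], of "inc c"]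
        by (auto simp: forest_pairs_def word_pairs_def words_def simp flip: set_mset_mset)
    next
      fix p
      assume "p \<in> word_pairs N M c"
      then obtain u v where p: "p = (u, v)" and uv: "nf u" "supported N u" "nf v"
        "supported (inc c) v" "c \<notin> set u" and M: "add_mset c (mset u + mset v) = M"
        by (auto simp: word_pairs_def)
      obtain A where A: "forest N A" "content A = mset u" "f N (mset u) A = u"
        using surj_f[OF uv(1,2) size1(1)[OF M]] by blast
      obtain B where B: "forest (inc c) B" "content B = mset v" "f (inc c) (mset v) B = v"
        using surj_f[OF uv(3,4) size1(2)[OF M]] by blast
      have "(A, B) \<in> forest_pairs N M c"
        using A B M uv(5) by (simp add: forest_pairs_def)
      moreover have "?h (A, B) = p"
        using A B p by simp
      ultimately show "p \<in> ?h ` forest_pairs N M c"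
        by (metis (no_types, lifting) imageI)
    qed
    moreover have "bij_betw (\<lambda>(A, B). A \<union> (#) c ` B) (forest_pairs N M c) (forests N M)"
      by (rule bij_betw_forests) (use c in auto)
    moreover have "bij_betw (\<lambda>(u, v). merge u (c # v)) (word_pairs N M c) (words N M)"
      by (rule bij_betw_words) (use c in auto)
    ultimately show ?thesis
      by (meson bij_betw_inv_into bij_betw_trans)
  qed
qed

text \<open>The sets belonging to different multisets are disjoint on both sides, so the bijections
  for single multisets combine.\<close>

lemma ex_content_preserving_bij:
  "\<exists>f. bij_betw f {A. forest N A} {w. nf w \<and> supported N w} \<and>
     (\<forall>A. forest N A \<longrightarrow> mset (f A) = content A)"
proof -
  obtain f where f: "\<And>M. bij_betw (f M) (forests N M) (words N M)"
    using ex_bij_betw_forests_words by metis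
  let ?f = "\<lambda>A. f (content A) A"
  have f': "f (content A) A \<in> words N (content A)" if "forest N A" for A
    using bij_betwE[OF f] that by (simp add: forests_def)
  have "inj_on ?f {A. forest N A}"
  proof (rule inj_onI)
    fix A B
    assume AB: "A \<in> {A. forest N A}" "B \<in> {A. forest N A}" "?f A = ?f B"
    then have "content A = content B"
      using f'[of A] f'[of B] by (simp add: words_def)
    then show "A = B"
      using AB bij_betw_imp_inj_on[OF f[of "content A"]] by (auto simp: inj_on_def forests_def)
  qed
  moreover have "?f ` {A. forest N A} = {w. nf w \<and> supported N w}"
  proof (intro set_eqI iffI)
    fix w
    assume "w \<in> {w. nf w \<and> supported N w}"
    then have "w \<in> f (mset w) ` forests N (mset w)"
      using bij_betw_imp_surj_on[OF f[of "mset w"]] by (simp add: words_def)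
    then obtain A where "forest N A" "content A = mset w" "w = f (mset w) A"
      by (auto simp: forests_def)
    then show "w \<in> ?f ` {A. forest N A}"
      by (intro image_eqI[of _ _ A]) auto
  qed (use f' in \<open>auto simp: words_def\<close>)
  ultimately show ?thesis
    using f' by (intro exI[of _ ?f]) (auto simp: bij_betw_def words_def)
qed

end

section \<open>Rooted trees and their tries\<close>

lemma walk_Nil [simp]: "\<not> walk T u [] v"
  by (simp add: walk_def)

lemma walk_single [simp]: "walk T u [x] v \<longleftrightarrow> x = u \<and> x = v \<and> x \<in> verts T"
  by (auto simp: walk_def)

lemma walk_append:
  assumes "walk T u xs v" "walk T v ys w"
  shows "walk T u (xs @ tl ys) w"
proof -
  obtain ys' where ys: "ys = v # ys'"
    using assms(2) by (cases ys) (auto simp: walk_def)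
  show ?thesis
    using assms unfolding ys by (cases ys') (auto simp: walk_def successively_append_iff)
qed

lemma walk_snoc:
  assumes "walk T u xs v" "{v, w} \<in> edges T" "w \<in> verts T"
  shows "walk T u (xs @ [w]) w"
  using assms by (auto simp: walk_def successively_append_iff)

lemma walk_rev: "walk T u xs v \<Longrightarrow> walk T v (rev xs) u"
  by (auto simp: walk_def hd_rev last_rev insert_commute successively_rev)

lemma walk_split_left: "walk T u (xs @ x # ys) v \<Longrightarrow> walk T u (xs @ [x]) x"
  by (auto simp: walk_def successively_append_iff hd_append)

lemma walk_split_right: "walk T u (xs @ x # ys) v \<Longrightarrow> walk T x (x # ys) v"
  by (auto simp: walk_def successively_append_iff)

text \<open>The closed stretch between two occurrences of a vertex can be cut out, which shortens
  the walk.\<close>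

lemma walk_distinct:
  assumes "walk T u xs v"
  shows "\<exists>ys. walk T u ys v \<and> distinct ys \<and> set ys \<subseteq> set xs"
  using assms
proof (induction "length xs" arbitrary: xs rule: less_induct)
  case less
  show ?case
  proof (cases "distinct xs")
    case False
    then obtain as x bs cs where xs: "xs = as @ [x] @ bs @ [x] @ cs"
      using not_distinct_decomp by blast
    have "walk T u (as @ [x]) x"
      by (rule walk_split_left[where ys = "bs @ [x] @ cs" and v = v]) (use less.prems xs in simp)
    moreover have "walk T x (x # cs) v"
      by (rule walk_split_right[where xs = "as @ [x] @ bs" and u = u]) (use less.prems xs in simp)
    ultimately have "walk T u (as @ x # cs) v"
      using walk_append by fastforce
    then show ?thesis
      using less.hyps[of "as @ x # cs"] xs by fastforce
  qed (use less.prems in blast)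
qed

section \<open>Depth and parents in a tree\<close>

locale rooted_tree =
  fixes T :: "'v rtree"
  assumes tree: "is_tree T" and rt_in: "rt T \<in> verts T"
begin

lemma edgeD:
  assumes "{u, v} \<in> edges T"
  shows "u \<in> verts T" "v \<in> verts T" "u \<noteq> v"
proof -
  have "\<forall>e\<in>edges T. \<exists>u\<in>verts T. \<exists>v\<in>verts T. u \<noteq> v \<and> e = {u, v}"
    using tree by (simp add: is_tree_def)
  from bspec[OF this assms]
  obtain x y where "x \<in> verts T" "y \<in> verts T" "x \<noteq> y" "{u, v} = {x, y}"
    by blast
  then show "u \<in> verts T" "v \<in> verts T" "u \<noteq> v"
    by (auto simp: doubleton_eq_iff)
qed

lemma depth_le: "walk T (rt T) xs v \<Longrightarrow> depth T v \<le> length xs - 1"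
  unfolding depth_def by (rule Least_le) (metis Suc_pred' length_greater_0_conv walk_Nil)

lemma shortest_walk:
  assumes "v \<in> verts T"
  obtains xs where "walk T (rt T) xs v" "length xs = Suc (depth T v)"
proof -
  have "\<forall>u\<in>verts T. \<forall>v\<in>verts T. \<exists>xs. walk T u xs v"
    using tree by (simp add: is_tree_def)
  then obtain xs where "walk T (rt T) xs v"
    using rt_in assms by blast
  then have "\<exists>k xs. walk T (rt T) xs v \<and> length xs = Suc k"
    by (metis Suc_pred' length_greater_0_conv walk_Nil)
  then have "\<exists>xs. walk T (rt T) xs v \<and> length xs = Suc (depth T v)"
    unfolding depth_def by (rule LeastI_ex)
  then show ?thesis
    using that by blast
qed

lemma depth_shortest_walk:
  assumes "walk T (rt T) xs v" "length xs = Suc (depth T v)" "x \<in> set xs"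
  shows "x = v \<or> depth T x < depth T v"
proof -
  obtain as bs where xs: "xs = as @ x # bs"
    using assms(3) by (auto simp: in_set_conv_decomp)
  show ?thesis
  proof (cases bs)
    case Nil
    then show ?thesis
      using assms(1) xs by (simp add: walk_def)
  next
    case Cons
    then show ?thesis
      using depth_le[OF walk_split_left[of T "rt T" as x bs v]] assms(1,2) xs by simp
  qed
qed

lemma depth_rt [simp]: "depth T (rt T) = 0"
  using depth_le[of "[rt T]"] rt_in by simp

lemma depth_eq_0: "v \<in> verts T \<Longrightarrow> depth T v = 0 \<Longrightarrow> v = rt T"
  by (rule shortest_walk[of v]) (auto simp: length_Suc_conv)

text \<open>Both shortest walks from the root avoid \<open>v\<close>, so two such neighbours would lie on a cycle
  through \<open>v\<close>.\<close>

lemma upper_neighbour_unique: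
  assumes "{u, v} \<in> edges T" "{u', v} \<in> edges T" "depth T u \<le> depth T v" "depth T u' \<le> depth T v"
  shows "u = u'"
proof (rule ccontr)
  assume "u \<noteq> u'"
  obtain xs where xs: "walk T (rt T) xs u" "length xs = Suc (depth T u)"
    using shortest_walk edgeD(1)[OF assms(1)] by blast
  obtain ys where ys: "walk T (rt T) ys u'" "length ys = Suc (depth T u')"
    using shortest_walk edgeD(1)[OF assms(2)] by blast
  have v: "v \<notin> set xs" "v \<notin> set ys"
    using depth_shortest_walk[OF xs] depth_shortest_walk[OF ys] assms edgeD(3) by force+
  have "walk T u (rev xs @ tl ys) u'"
    by (rule walk_append[OF walk_rev[OF xs(1)] ys(1)])
  then obtain zs where zs: "walk T u zs u'" "distinct zs" "set zs \<subseteq> set (rev xs @ tl ys)"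
    using walk_distinct by metis
  then have vz: "v \<notin> set zs"
    using v by (cases ys) auto
  have "length zs \<noteq> 0" "length zs \<noteq> 1"
    using zs(1) \<open>u \<noteq> u'\<close> by (auto simp: length_Suc_conv)
  then have "length zs \<ge> 2"
    by linarith
  then have "length (zs @ [v]) \<ge> 3"
    by simp
  moreover have "walk T u (zs @ [v]) v"
    using walk_snoc[OF zs(1) assms(2)] edgeD(2)[OF assms(1)] by blast
  moreover have "distinct (zs @ [v])" "{v, u} \<in> edges T"
    using zs(2) vz assms(1) by (auto simp: insert_commute)
  moreover have "\<not> (\<exists>u xs v. walk T u xs v \<and> distinct xs \<and> length xs \<ge> 3 \<and> {v, u} \<in> edges T)"
    using tree by (simp only: is_tree_def not_False_eq_True simp_thms)
  ultimately show False
    by blast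
qed

lemma ex_parent:
  assumes "v \<in> nonroot T"
  shows "\<exists>u. {u, v} \<in> edges T \<and> depth T v = Suc (depth T u)"
proof -
  have v: "v \<in> verts T" "v \<noteq> rt T"
    using assms by (auto simp: nonroot_def)
  obtain xs where xs: "walk T (rt T) xs v" "length xs = Suc (depth T v)"
    using shortest_walk[OF v(1)] .
  have "depth T v \<noteq> 0"
    using depth_eq_0 v by blast
  \<comment> \<open>The neighbour sought is the predecessor of \<open>v\<close> on a shortest walk;
    positive depth guarantees that there is one.\<close>
  then obtain as u where as: "xs = as @ [u, v]"
    using xs by (cases xs rule: rev_cases; cases "butlast xs" rule: rev_cases)
      (auto simp: walk_def)
  have w: "walk T (rt T) (as @ [u]) u" "{u, v} \<in> edges T"
    using walk_split_left[of T "rt T" as u "[v]" v] xs(1) as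
    by (auto simp: walk_def successively_append_iff)
  obtain ys where ys: "walk T (rt T) ys u" "length ys = Suc (depth T u)"
    using shortest_walk edgeD(1)[OF w(2)] by blast
  have "depth T v \<le> Suc (depth T u)"
    using depth_le[OF walk_snoc[OF ys(1) w(2) v(1)]] ys(2) by simp
  then show ?thesis
    using depth_le[OF w(1)] w(2) xs(2) as by (intro exI[of _ u]) simp
qed

lemma parent_nonroot:
  assumes "v \<in> nonroot T"
  shows "{parent T v, v} \<in> edges T" "depth T v = Suc (depth T (parent T v))"
proof -
  obtain u where u: "{u, v} \<in> edges T" "depth T v = Suc (depth T u)"
    using ex_parent[OF assms] by blast
  then have "parent T v = u"
    unfolding parent_def using upper_neighbour_unique[of _ v u] by (intro the_equality) auto
  with u show "{parent T v, v} \<in> edges T" "depth T v = Suc (depth T (parent T v))"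
    by auto
qed

text \<open>\<open>upper_neighbour_unique\<close> allows equal depths, so \<open>u\<close> must
  coincide with the parent of \<open>v\<close>; in particular no edge joins vertices of equal
  depth.\<close>

lemma edge_lower:
  assumes "{u, v} \<in> edges T" "depth T u \<le> depth T v"
  shows "v \<in> nonroot T \<and> u = parent T v"
proof -
  have "v \<noteq> rt T"
    using assms edgeD[OF assms(1)] depth_eq_0[of u] by auto
  then have v: "v \<in> nonroot T"
    using edgeD[OF assms(1)] by (simp add: nonroot_def)
  then show ?thesis
    using upper_neighbour_unique[OF assms(1) parent_nonroot(1)[OF v] assms(2)] parent_nonroot(2)[OF v]
    by simp
qed

lemma edge_iff_parent:
  "{u, v} \<in> edges T \<longleftrightarrow> (v \<in> nonroot T \<and> u = parent T v) \<or> (u \<in> nonroot T \<and> v = parent T u)"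
proof
  assume e: "{u, v} \<in> edges T"
  then show "(v \<in> nonroot T \<and> u = parent T v) \<or> (u \<in> nonroot T \<and> v = parent T u)"
    using edge_lower[of u v] edge_lower[of v u] by (metis insert_commute nle_le)
qed (use parent_nonroot(1) in \<open>auto simp: insert_commute\<close>)

lemma parent_in_verts: "v \<in> nonroot T \<Longrightarrow> parent T v \<in> verts T"
  using parent_nonroot(1) edgeD(1) by blast

end

section \<open>Letter sequences of vertices\<close>

primrec ancestor_letters :: "'v rtree \<Rightarrow> nat \<Rightarrow> 'v \<Rightarrow> (nat \<times> nat) list" where
  "ancestor_letters T 0 v = []"
| "ancestor_letters T (Suc k) v = ancestor_letters T k (parent T v) @ [(label T v, level T v)]"

text \<open>The depth counts the parent steps up to the root, so the recursion stops exactly there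
  and the root contributes no letter.\<close>

definition path :: "'v rtree \<Rightarrow> 'v \<Rightarrow> (nat \<times> nat) list" where
  "path T v = ancestor_letters T (depth T v) v"

context rooted_tree
begin

lemma path_rt [simp]: "path T (rt T) = []"
  by (simp add: path_def)

lemma path_nonroot:
  "v \<in> nonroot T \<Longrightarrow> path T v = path T (parent T v) @ [(label T v, level T v)]"
  by (simp add: path_def parent_nonroot(2))

lemma verts_cases:
  assumes "v \<in> verts T"
  obtains "v = rt T" | "v \<in> nonroot T"
  using assms by (auto simp: nonroot_def)

end

text \<open>One interface for two uses: \<open>path T\<close> on a given tree, and a graph built
  from a given trie. That \<open>T\<close> is a tree is then a consequence, since every edge extends
  a sequence by one letter.\<close>

locale trie_model =
  fixes T :: "'v rtree" and h :: "'v \<Rightarrow> (nat \<times> nat) list" and A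
  assumes trie: "trie A"
    and bij: "bij_betw h (verts T) A"
    and rt_in: "rt T \<in> verts T"
    and h_rt: "h (rt T) = []"
    and edges_verts: "e \<in> edges T \<Longrightarrow> \<exists>u\<in>verts T. \<exists>v\<in>verts T. e = {u, v}"
    and edges_iff: "\<lbrakk>u \<in> verts T; v \<in> verts T\<rbrakk> \<Longrightarrow>
      {u, v} \<in> edges T \<longleftrightarrow> (\<exists>a. h v = h u @ [a] \<or> h u = h v @ [a])"
    and rt_label: "label T (rt T) = 0" "level T (rt T) = 0"
    and last_h: "v \<in> nonroot T \<Longrightarrow> last (h v) = (label T v, level T v)"

lemma trie_model_path:
  assumes "tiered_rooted_tree T"
  shows "trie_model T (path T) (path T ` verts T)"
proof -
  interpret rooted_tree T
    using assms by unfold_locales (auto simp: tiered_rooted_tree_def)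
  have fin: "finite (verts T)"
    using tree by (simp add: is_tree_def)
  \<comment> \<open>Equal paths give equal letters and, by induction, equal parents; siblings with
    equal letters coincide.\<close>
  have inj: "u = v" if "u \<in> verts T" "v \<in> verts T" "path T u = path T v" for u v
    using that
  proof (induction "path T u" arbitrary: u v rule: rev_induct)
    case Nil
    then show ?case
      using path_nonroot by (metis snoc_eq_iff_butlast verts_cases)
  next
    case (snoc a x)
    then have uv: "u \<in> nonroot T" "v \<in> nonroot T"
      by (metis path_rt snoc_eq_iff_butlast verts_cases)+
    have "parent T u = parent T v"
      by (rule snoc.hyps(1)) (use snoc path_nonroot uv parent_in_verts in auto)
    moreover have "(label T u, level T u) = (label T v, level T v)"
      using snoc path_nonroot uv by auto
    ultimately show ?case
      using assms uv unfolding tiered_rooted_tree_def by blast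
  qed
  show ?thesis
  proof
    show "trie (path T ` verts T)"
      unfolding trie_def
    proof (intro conjI allI impI)
      show "[] \<in> path T ` verts T"
        using rt_in path_rt by (metis imageI)
      fix x a
      assume "x @ [a] \<in> path T ` verts T"
      then obtain v where v: "v \<in> verts T" "path T v = x @ [a]"
        by (metis imageE)
      then have "v \<in> nonroot T"
        by (metis path_rt snoc_eq_iff_butlast verts_cases)
      then show "x \<in> path T ` verts T"
        using path_nonroot v(2) parent_in_verts by (metis butlast_snoc imageI)
    qed (use fin in simp)
    show "bij_betw (path T) (verts T) (path T ` verts T)"
      using inj by (auto simp: bij_betw_def inj_on_def)
    show "\<exists>u\<in>verts T. \<exists>v\<in>verts T. e = {u, v}" if "e \<in> edges T" for e
      using tree that by (fastforce simp: is_tree_def)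
    have child: "v \<in> nonroot T \<and> u = parent T v \<longleftrightarrow> (\<exists>a. path T v = path T u @ [a])"
      if "u \<in> verts T" "v \<in> verts T" for u v
    proof
      assume "\<exists>a. path T v = path T u @ [a]"
      then obtain a where a: "path T v = path T u @ [a]"
        by blast
      then have v: "v \<in> nonroot T"
        using that(2) by (metis path_rt snoc_eq_iff_butlast verts_cases)
      then have "path T (parent T v) = path T u"
        using path_nonroot a by auto
      then show "v \<in> nonroot T \<and> u = parent T v"
        using inj v parent_in_verts that(1) by metis
    qed (use path_nonroot in blast)
    show "{u, v} \<in> edges T \<longleftrightarrow> (\<exists>a. path T v = path T u @ [a] \<or> path T u = path T v @ [a])"
      if "u \<in> verts T" "v \<in> verts T" for u v
      using edge_iff_parent child[OF that] child[OF that(2,1)] by blast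
    show "last (path T v) = (label T v, level T v)" if "v \<in> nonroot T" for v
      using path_nonroot[OF that] by simp
  qed (use assms in \<open>auto simp: tiered_rooted_tree_def\<close>)
qed

section \<open>Trees modelled on a trie\<close>

context trie_model
begin

lemma h_in: "v \<in> verts T \<Longrightarrow> h v \<in> A"
  using bij by (rule bij_betw_apply)

lemma h_inj: "\<lbrakk>u \<in> verts T; v \<in> verts T; h u = h v\<rbrakk> \<Longrightarrow> u = v"
  using bij by (auto simp: bij_betw_def inj_on_def)

lemma ex_vert: "x \<in> A \<Longrightarrow> \<exists>v\<in>verts T. h v = x"
  using bij by (auto simp: bij_betw_def)

lemma nonroot_iff: "v \<in> nonroot T \<longleftrightarrow> v \<in> verts T \<and> h v \<noteq> []"
  using h_inj[of v "rt T"] rt_in h_rt by (auto simp: nonroot_def)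

lemma ex_nonroot: "x @ [a] \<in> A \<Longrightarrow> \<exists>v\<in>nonroot T. h v = x @ [a]"
  using ex_vert nonroot_iff by (metis snoc_eq_iff_butlast)

lemma ex_butlast: "v \<in> nonroot T \<Longrightarrow> \<exists>u\<in>verts T. h u = butlast (h v)"
  using ex_vert trie h_in unfolding nonroot_iff trie_def by (metis append_butlast_last_id)

lemma edgeE:
  assumes "{u, v} \<in> edges T"
  obtains "u \<in> verts T" "v \<in> verts T" "\<exists>a. h v = h u @ [a] \<or> h u = h v @ [a]"
proof -
  have "u \<in> verts T \<and> v \<in> verts T"
    using edges_verts[OF assms] by (auto simp: doubleton_eq_iff)
  then show ?thesis
    using that edges_iff assms by blast
qed

lemma root_walk: "v \<in> verts T \<Longrightarrow> \<exists>xs. walk T (rt T) xs v \<and> length xs = Suc (length (h v))"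
proof (induction "h v" arbitrary: v rule: rev_induct)
  case Nil
  then have "v = rt T"
    using h_inj h_rt rt_in by metis
  then have "walk T (rt T) [rt T] v"
    using rt_in by simp
  then show ?case
    using Nil by (intro exI[of _ "[rt T]"]) simp
next
  case (snoc a x)
  then have "v \<in> nonroot T"
    by (metis nonroot_iff snoc_eq_iff_butlast)
  then obtain u where u: "u \<in> verts T" "h u = x"
    using ex_butlast snoc.hyps(2) by (metis butlast_snoc)
  then obtain xs where xs: "walk T (rt T) xs u" "length xs = Suc (length x)"
    using snoc.hyps(1)[of u] by auto
  have "{u, v} \<in> edges T"
    using edges_iff[OF u(1) snoc.prems] u(2) snoc.hyps(2) by metis
  then have "walk T (rt T) (xs @ [v]) v"
    using walk_snoc[OF xs(1)] snoc.prems by blast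
  moreover have "length (xs @ [v]) = Suc (length (h v))"
    using xs(2) snoc.hyps(2)[symmetric] by simp
  ultimately show ?case
    by blast
qed

text \<open>An edge adds at most one letter, and a walk has one edge less than it has vertices,
  whence the strict inequality.\<close>

lemma length_walk: "walk T u xs v \<Longrightarrow> length (h v) < length (h u) + length xs"
proof (induction xs arbitrary: u)
  case (Cons x xs)
  have x: "x = u"
    using Cons.prems by (simp add: walk_def)
  show ?case
  proof (cases xs)
    case Nil
    then show ?thesis
      using Cons.prems by auto
  next
    case (Cons y ys)
    have "walk T y xs v"
      using walk_split_right[of T u "[x]" y ys v] Cons.prems Cons by simp
    then have "length (h v) < length (h y) + length xs"
      by (rule Cons.IH)
    moreover have "{u, y} \<in> edges T"
      using Cons.prems Cons x by (simp add: walk_def)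
    then have "length (h y) \<le> Suc (length (h u))"
      by (rule edgeE) auto
    ultimately show ?thesis
      by simp
  qed
qed simp

lemma depth_eq: "v \<in> verts T \<Longrightarrow> depth T v = length (h v)"
  unfolding depth_def
proof (rule Least_equality)
  fix k
  assume "\<exists>xs. walk T (rt T) xs v \<and> length xs = Suc k"
  then show "length (h v) \<le> k"
    using length_walk h_rt by fastforce
qed (rule root_walk)

lemma upper_neighbour:
  "{u, v} \<in> edges T \<Longrightarrow> length (h u) \<le> length (h v) \<Longrightarrow> h u = butlast (h v)"
  by (erule edgeE) auto

text \<open>Both neighbours on a cycle of a vertex of maximal depth would be its parent.\<close>

lemma acyclic:
  assumes "walk T u xs v" "distinct xs" "length xs \<ge> 3" "{v, u} \<in> edges T"
  shows False
proof -
  define L where "L = length xs"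
  have L: "L \<ge> 3"
    using assms(3) by (simp add: L_def)
  have edge: "{xs ! i, xs ! (Suc i mod L)} \<in> edges T" if "i < L" for i
  proof (cases "Suc i = L")
    case True
    then have "i = length xs - 1"
      by (simp add: L_def)
    moreover have "xs \<noteq> []" "hd xs = u" "last xs = v"
      using assms(1) by (auto simp: walk_def)
    ultimately have "xs ! i = v" "xs ! 0 = u"
      by (auto simp: last_conv_nth hd_conv_nth)
    then show ?thesis
      using assms(4) True by simp
  next
    case False
    then show ?thesis
      using assms(1) that by (simp add: walk_def L_def successively_conv_nth)
  qed
  define m where "m = Max ((\<lambda>i. length (h (xs ! i))) ` {..<L})"
  have "m \<in> (\<lambda>i. length (h (xs ! i))) ` {..<L}"
    unfolding m_def by (rule Max_in) (use L in \<open>auto simp: lessThan_empty_iff\<close>)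
  then obtain i where i: "i < L" "length (h (xs ! i)) = m"
    by auto
  have max: "length (h (xs ! j)) \<le> m" if "j < L" for j
    unfolding m_def using that by (intro Max_ge) auto
  \<comment> \<open>\<open>j\<close> and \<open>k\<close> are the cyclic successor and predecessor
    of \<open>i\<close>; the case \<open>i = 0\<close> avoids truncated subtraction. They differ
    because \<open>L \<ge> 3\<close>.\<close>
  define j k where "j = Suc i mod L" and "k = (if i = 0 then L - 1 else i - 1)"
  have jk: "j < L" "k < L" "Suc k mod L = i"
    using i(1) L by (auto simp: j_def k_def)
  have "h (xs ! j) = butlast (h (xs ! i))"
    using upper_neighbour[of "xs ! j" "xs ! i"] edge[OF i(1)] max[OF jk(1)] i(2)
    by (simp add: j_def insert_commute)
  moreover have "h (xs ! k) = butlast (h (xs ! i))"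
    using upper_neighbour[of "xs ! k" "xs ! i"] edge[OF jk(2)] max[OF jk(2)] i(2) jk(3) by simp
  ultimately have "xs ! j = xs ! k"
    using h_inj assms(1) jk(1,2) unfolding walk_def L_def by (metis nth_mem subsetD)
  then have "j = k"
    using assms(2) jk by (simp add: nth_eq_iff_index_eq L_def)
  moreover have "j \<noteq> k"
  proof (cases "Suc i = L")
    case True
    then show ?thesis
      using L by (auto simp: j_def k_def)
  next
    case False
    then show ?thesis
      using L i(1) by (auto simp: j_def k_def)
  qed
  ultimately show False
    by simp
qed

lemma is_tree: "is_tree T"
  unfolding is_tree_def
proof (intro conjI ballI)
  show "finite (verts T)"
    using bij_betw_finite[OF bij] trie by (simp add: trie_def)
  show "verts T \<noteq> {}"
    using rt_in by blast
  show "\<exists>u\<in>verts T. \<exists>v\<in>verts T. u \<noteq> v \<and> e = {u, v}" if e: "e \<in> edges T" for e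
  proof -
    obtain u v where uv: "u \<in> verts T" "v \<in> verts T" "e = {u, v}"
      using edges_verts[OF e] by blast
    then have "u \<noteq> v"
      using edges_iff[OF uv(1,2)] e by auto
    then show ?thesis
      using uv by blast
  qed
  show "\<exists>xs. walk T u xs v" if "u \<in> verts T" "v \<in> verts T" for u v
    using root_walk that walk_rev walk_append by metis
  show "\<not> (\<exists>u xs v. walk T u xs v \<and> distinct xs \<and> length xs \<ge> 3 \<and> {v, u} \<in> edges T)"
    using acyclic by blast
qed

lemma parent_props:
  assumes "v \<in> nonroot T"
  shows "parent T v \<in> verts T" "h (parent T v) = butlast (h v)"
proof -
  have v: "v \<in> verts T" "h v \<noteq> []"
    using assms by (auto simp: nonroot_iff)
  obtain u where u: "u \<in> verts T" "h u = butlast (h v)"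
    using ex_butlast[OF assms] by blast
  have e: "{u, v} \<in> edges T"
    using edges_iff[OF u(1) v(1)] u(2) v(2) by (metis append_butlast_last_id)
  have "parent T v = u"
    unfolding parent_def
  proof (rule the_equality)
    show "{u, v} \<in> edges T \<and> depth T u < depth T v"
      using e u v by (simp add: depth_eq)
    fix w
    assume w: "{w, v} \<in> edges T \<and> depth T w < depth T v"
    then have "w \<in> verts T"
      by (meson edgeE)
    then show "w = u"
      using upper_neighbour[of w v] w u v h_inj depth_eq by auto
  qed
  then show "parent T v \<in> verts T" "h (parent T v) = butlast (h v)"
    using u by auto
qed

lemma h_nonroot: "v \<in> nonroot T \<Longrightarrow> h v = h (parent T v) @ [(label T v, level T v)]"
  using parent_props last_h by (metis append_butlast_last_id nonroot_iff)

lemma descendant_imp: "descendant T v u \<Longrightarrow> \<exists>y. y \<noteq> [] \<and> h v = h u @ y"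
  unfolding descendant_def
proof (induction rule: trancl_induct)
  case (base u)
  then show ?case
    using h_nonroot by auto
next
  case (step u w)
  then show ?case
    using h_nonroot by auto
qed

lemma descendant_if:
  "\<lbrakk>v \<in> verts T; u \<in> verts T; h v = h u @ y; y \<noteq> []\<rbrakk> \<Longrightarrow> descendant T v u"
proof (induction y arbitrary: v rule: rev_induct)
  case (snoc a y)
  have v: "v \<in> nonroot T"
    using snoc.prems by (simp add: nonroot_iff)
  have p: "parent T v \<in> verts T" "h (parent T v) = h u @ y"
    using parent_props[OF v] snoc.prems(3) by (auto simp: butlast_append)
  have e: "(v, parent T v) \<in> {(x, parent T x) | x. x \<in> nonroot T}"
    using v by blast
  show ?case
  proof (cases "y = []")
    case True
    then have "parent T v = u"
      using p h_inj snoc.prems(2) by simp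
    then show ?thesis
      using e unfolding descendant_def by auto
  next
    case False
    then have "descendant T (parent T v) u"
      using snoc.IH p snoc.prems(2) by blast
    then show ?thesis
      using e unfolding descendant_def by (rule trancl_into_trancl2[rotated])
  qed
qed simp

end

section \<open>Isomorphism of trees and equality of tries\<close>

lemma trie_model_iso_imp_eq:
  assumes S: "trie_model S h A" and T: "trie_model T k B" and iso: "tree_iso S T"
  shows "A = B"
proof -
  interpret S: trie_model S h A by (rule S)
  interpret T: trie_model T k B by (rule T)
  obtain f where f: "bij_betw f (verts S) (verts T)"
    "\<And>u v. \<lbrakk>u \<in> verts S; v \<in> verts S\<rbrakk> \<Longrightarrow> {u, v} \<in> edges S \<longleftrightarrow> {f u, f v} \<in> edges T"
    "f (rt S) = rt T"
    "\<And>v. v \<in> verts S \<Longrightarrow> label T (f v) = label S v \<and> level T (f v) = level S v"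
    using iso unfolding tree_iso_def by blast
  have fv: "f v \<in> verts T" if "v \<in> verts S" for v
    using f(1) that by (rule bij_betw_apply)
  have f_inj: "u = v" if "u \<in> verts S" "v \<in> verts S" "f u = f v" for u v
    using f(1) that by (auto simp: bij_betw_def inj_on_def)
  \<comment> \<open>Induction on the depth shows that \<open>f\<close> preserves whole letter
    sequences, so both tries are the same image.\<close>
  have k: "k (f v) = h v" if "v \<in> verts S" for v
    using that
  proof (induction "length (h v)" arbitrary: v rule: less_induct)
    case less
    show ?case
    proof (cases "v \<in> nonroot S")
      case False
      then have "v = rt S"
        using less.prems by (simp add: nonroot_def)
      then show ?thesis
        using f(3) S.h_rt T.h_rt by simp
    next
      case v: True
      define u where "u = parent S v"
      have u: "u \<in> verts S" "h v = h u @ [(label S v, level S v)]"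
        using S.parent_props(1)[OF v] S.h_nonroot[OF v] by (auto simp: u_def)
      have ku: "k (f u) = h u"
        using less.hyps[OF _ u(1)] u(2) by simp
      have "{u, v} \<in> edges S"
        using S.edges_iff[OF u(1) less.prems] u(2) by blast
      then have "{f u, f v} \<in> edges T"
        using f(2) u(1) less.prems by blast
      then obtain a where "k (f v) = k (f u) @ [a] \<or> k (f u) = k (f v) @ [a]"
        using T.edges_iff[OF fv[OF u(1)] fv[OF less.prems]] by blast
      then show ?thesis
      proof
        assume a: "k (f v) = k (f u) @ [a]"
        then have "f v \<in> nonroot T"
          using T.nonroot_iff fv[OF less.prems] by simp
        then have "a = (label T (f v), level T (f v))"
          using T.last_h a by (metis last_snoc)
        then show ?thesis
          using a ku u(2) f(4)[OF less.prems] by simp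
      next
        \<comment> \<open>Edges are preserved, but a priori not their direction. If
          \<open>f v\<close> were the parent of \<open>f u\<close>, it would be the image of the
          parent \<open>w\<close> of \<open>u\<close>, so \<open>w = v\<close> by injectivity,
          although the sequence of \<open>w\<close> is too short.\<close>
        assume a: "k (f u) = k (f v) @ [a]"
        then have "h u \<noteq> []"
          using ku by simp
        then have un: "u \<in> nonroot S"
          using S.nonroot_iff u(1) by simp
        define w where "w = parent S u"
        have w: "w \<in> verts S" "h w = butlast (h u)"
          using S.parent_props[OF un] by (auto simp: w_def)
        have "k (f w) = h w"
          using less.hyps[OF _ w(1)] w(2) u(2) by simp
        then have "k (f w) = k (f v)"
          using w(2) a ku by (metis butlast_snoc)
        then have "w = v"
          using T.h_inj fv w(1) less.prems f_inj by metis
        then have False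
          using w(2) u(2) by (metis length_append_singleton length_butlast diff_le_self not_less_eq_eq order_refl le_SucI)
        then show ?thesis ..
      qed
    qed
  qed
  have "A = h ` verts S"
    using S.bij by (simp add: bij_betw_def)
  also have "\<dots> = k ` f ` verts S"
    using k by force
  also have "\<dots> = B"
    using f(1) T.bij by (simp add: bij_betw_def)
  finally show ?thesis .
qed

text \<open>The map matching vertices with the same sequence works, because sequences determine
  adjacency, labels and levels.\<close>

lemma trie_model_imp_iso:
  assumes S: "trie_model S h A" and T: "trie_model T k A"
  shows "tree_iso S T"
proof -
  interpret S: trie_model S h A by (rule S)
  interpret T: trie_model T k A by (rule T)
  define f where "f v = inv_into (verts T) k (h v)" for v
  have kf: "f v \<in> verts T" "k (f v) = h v" if "v \<in> verts S" for v
    using T.bij S.h_in[OF that] unfolding f_def bij_betw_def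
    by (auto simp: inv_into_into f_inv_into_f)
  have "bij_betw f (verts S) (verts T)"
    using bij_betw_trans[OF S.bij bij_betw_inv_into[OF T.bij]] by (simp add: f_def comp_def cong: bij_betw_cong)
  moreover have "f (rt S) = rt T"
    using kf[OF S.rt_in] S.h_rt T.h_rt T.h_inj T.rt_in by metis
  moreover have "label T (f v) = label S v \<and> level T (f v) = level S v" if v: "v \<in> verts S" for v
  proof (cases "h v = []")
    case True
    then have "v = rt S"
      using S.h_inj S.rt_in S.h_rt v by metis
    then show ?thesis
      using \<open>f (rt S) = rt T\<close> S.rt_label T.rt_label by simp
  next
    case False
    then have "v \<in> nonroot S" "f v \<in> nonroot T"
      using S.nonroot_iff T.nonroot_iff v kf[OF v] by auto
    then show ?thesis
      using S.last_h[of v] T.last_h[of "f v"] kf(2)[OF v] by simp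
  qed
  moreover have "{u, v} \<in> edges S \<longleftrightarrow> {f u, f v} \<in> edges T" if "u \<in> verts S" "v \<in> verts S" for u v
    using S.edges_iff T.edges_iff kf that by simp
  ultimately show ?thesis
    unfolding tree_iso_def by blast
qed

text \<open>The sequences are renamed by an injection into the naturals, since the isomorphism
  classes consist of trees on natural numbers. The empty sequence, which has no last letter, gets
  label and level 0.\<close>

lemma ex_trie_model:
  fixes A :: "(nat \<times> nat) list set"
  assumes "trie A"
  shows "\<exists>(T :: nat rtree) h. trie_model T h A"
proof -
  obtain e :: "(nat \<times> nat) list \<Rightarrow> nat" where e: "inj_on e A"
    using finite_imp_inj_to_nat_seg[of A] assms unfolding trie_def by blast
  define h where "h = inv_into A e"
  have h: "h (e x) = x" if "x \<in> A" for x
    using e that by (simp add: h_def)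
  have pre: "x \<in> A" if "x @ [a] \<in> A" for x a
    using assms that unfolding trie_def by blast
  have nil: "[] \<in> A"
    using assms by (simp add: trie_def)
  define T where "T = \<lparr>verts = e ` A, edges = {{e x, e (x @ [a])} | x a. x @ [a] \<in> A}, rt = e [],
    label = (\<lambda>v. if h v = [] then 0 else fst (last (h v))),
    level = (\<lambda>v. if h v = [] then 0 else snd (last (h v)))\<rparr>"
  have "trie_model T h A"
  proof
    show "bij_betw h (verts T) A"
      unfolding T_def h_def using bij_betw_inv_into[OF inj_on_imp_bij_betw[OF e]] by simp
    show "\<exists>u\<in>verts T. \<exists>v\<in>verts T. f = {u, v}" if "f \<in> edges T" for f
      using that pre unfolding T_def by auto
    show "last (h v) = (label T v, level T v)" if "v \<in> nonroot T" for v
    proof -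
      obtain x where "v = e x" "x \<in> A" "x \<noteq> []"
        using \<open>v \<in> nonroot T\<close> by (auto simp: T_def nonroot_def)
      then show ?thesis
        using h by (simp add: T_def)
    qed
    show "{u, v} \<in> edges T \<longleftrightarrow> (\<exists>a. h v = h u @ [a] \<or> h u = h v @ [a])"
      if uv: "u \<in> verts T" "v \<in> verts T" for u v
    proof
      assume "{u, v} \<in> edges T"
      then obtain x a where xa: "x @ [a] \<in> A" "{u, v} = {e x, e (x @ [a])}"
        by (auto simp: T_def)
      moreover have "h (e (x @ [a])) = h (e x) @ [a]"
        using h[OF xa(1)] h[OF pre[OF xa(1)]] by simp
      ultimately show "\<exists>a. h v = h u @ [a] \<or> h u = h v @ [a]"
        by (metis doubleton_eq_iff)
    next
      obtain x y where xy: "u = e x" "v = e y" "x \<in> A" "y \<in> A"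
        using uv by (auto simp: T_def)
      assume "\<exists>a. h v = h u @ [a] \<or> h u = h v @ [a]"
      then obtain a where "y = x @ [a] \<or> x = y @ [a]"
        using xy h by auto
      then have "{u, v} = {e x, e (x @ [a])} \<and> x @ [a] \<in> A \<or> {u, v} = {e y, e (y @ [a])} \<and> y @ [a] \<in> A"
        using xy by (auto simp: insert_commute)
      then show "{u, v} \<in> edges T"
        unfolding T_def rtree.select_convs mem_Collect_eq by blast
    qed
  qed (use assms h[OF nil] nil in \<open>auto simp: T_def\<close>)
  then show ?thesis
    by blast
qed

section \<open>The bijection\<close>

definition letter_le :: "nat \<times> nat \<Rightarrow> nat \<times> nat \<Rightarrow> bool" where
  "letter_le p q \<longleftrightarrow> fst p \<le> fst q \<and> snd q \<le> snd p"

text \<open>Levels are compared in reverse, so that for the letters of \<open>u\<close> and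
  \<open>v\<close>, in this order, the negation is exactly the last condition of
  \<open>inversion T u v\<close>.\<close>

definition letter_prec :: "nat \<times> nat \<Rightarrow> nat \<times> nat \<Rightarrow> bool" where
  "letter_prec p q \<longleftrightarrow> fst p < fst q \<or> fst p = fst q \<and> snd q \<le> snd p"

interpretation letters: ordered_alphabet letter_le letter_prec
  by unfold_locales (auto simp: letter_le_def letter_prec_def prod_eq_iff)

lemma inc_letters_iff:
  "letters.inc p q \<longleftrightarrow> fst p < fst q \<and> snd p < snd q \<or> fst q < fst p \<and> snd q < snd p"
  by (auto simp: letters.inc_def letter_le_def)

lemma inc_letters_commute: "letters.inc p q \<longleftrightarrow> letters.inc q p"
  by (auto simp: letters.inc_def)

abbreviation good_trie :: "(nat \<times> nat) list set \<Rightarrow> bool" where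
  "good_trie A \<equiv> letters.forest (\<lambda>_. True) A \<and> (\<forall>p\<in>#content A. 1 \<le> fst p \<and> 1 \<le> snd p)"

lemma count_image_mset_set:
  assumes "finite X"
  shows "count (image_mset f (mset_set X)) i = card {x \<in> X. f x = i}"
proof -
  have "count (image_mset f (mset_set X)) i = (\<Sum>x\<in>{x \<in> X. f x = i}. 1)"
    unfolding count_image_mset' by (rule sum.cong) (use assms in auto)
  then show ?thesis
    by simp
qed

section \<open>Inversion-free tiered trees as good tries\<close>

context trie_model
begin

lemma compatible_nonroot:
  "\<lbrakk>u \<in> nonroot T; v \<in> nonroot T\<rbrakk> \<Longrightarrow> compatible T u v \<longleftrightarrow> letters.inc (last (h u)) (last (h v))"
  by (auto simp: compatible_def inc_letters_iff last_h)

text \<open>The root has label and level 0, so every positive letter is compatible with it; this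
  matches the condition \<open>\<lambda>_. True\<close> at the root.\<close>

lemma compatible_iff_start:
  assumes "u \<in> verts T" "v \<in> nonroot T" "label T v \<ge> 1" "level T v \<ge> 1"
  shows "compatible T v u \<longleftrightarrow> letters.start (\<lambda>_. True) (h u) (last (h v))"
proof (cases "h u = []")
  case True
  then have "u = rt T"
    using h_inj assms(1) rt_in h_rt by metis
  then show ?thesis
    using True assms by (simp add: compatible_def rt_label)
next
  case False
  then have "u \<in> nonroot T"
    using assms(1) by (simp add: nonroot_iff)
  then show ?thesis
    using False compatible_nonroot assms(2) inc_letters_commute by (simp add: letters.start_def)
qed

lemma edge_nonroot_compatible_iff:
  "(label T u \<noteq> label T v \<and> level T u \<noteq> level T v \<and>
     (label T u < label T v \<longleftrightarrow> level T u < level T v)) \<longleftrightarrow> compatible T u v"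
  by (auto simp: compatible_def)

lemma content_eq: "content A = image_mset (\<lambda>v. (label T v, level T v)) (mset_set (nonroot T))"
proof -
  have "A = h ` verts T"
    using bij by (simp add: bij_betw_def)
  then have "A - {[]} = h ` nonroot T"
    by (auto simp: nonroot_iff)
  moreover have "inj_on h (nonroot T)"
    using h_inj nonroot_iff by (auto simp: inj_on_def)
  ultimately have "mset_set (A - {[]}) = image_mset h (mset_set (nonroot T))"
    by (simp add: image_mset_mset_set)
  then have "content A = image_mset (last \<circ> h) (mset_set (nonroot T))"
    by (simp add: content_def multiset.map_comp)
  also have "\<dots> = image_mset (\<lambda>v. (label T v, level T v)) (mset_set (nonroot T))"
    by (rule image_mset_cong) (metis comp_apply elem_mset_set empty_iff infinite_set_mset_mset_set last_h)
  finally show ?thesis .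
qed

lemma finite_nonroot: "finite (nonroot T)"
  using is_tree by (simp add: is_tree_def nonroot_def)

lemma positive_content_iff:
  "(\<forall>p\<in>#content A. 1 \<le> fst p \<and> 1 \<le> snd p) \<longleftrightarrow> (\<forall>v\<in>nonroot T. label T v \<ge> 1 \<and> level T v \<ge> 1)"
  using finite_nonroot by (simp add: content_eq)

lemma alpha_tree_eq: "alpha_tree T = count (image_mset fst (content A))"
  using finite_nonroot
  by (simp add: fun_eq_iff alpha_tree_def content_eq multiset.map_comp comp_def
      count_image_mset_set)

lemma beta_tree_eq: "beta_tree T = count (image_mset snd (content A))"
  using finite_nonroot
  by (simp add: fun_eq_iff beta_tree_def content_eq multiset.map_comp comp_def
      count_image_mset_set)

lemma card_verts: "card (verts T) = card A"
  using bij by (rule bij_betw_same_card)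

text \<open>The condition on edges becomes admissibility of each letter below its parent, and the
  absence of inversions becomes the last clause of \<open>forest\<close>.\<close>

lemma good_trie_if_tiered:
  assumes tiered: "tiered_rooted_tree T" and inv: "\<not> (\<exists>u v. inversion T u v)"
  shows "good_trie A"
proof -
  have pos: "label T v \<ge> 1" "level T v \<ge> 1" if "v \<in> nonroot T" for v
    using tiered that by (auto simp: tiered_rooted_tree_def)
  have "letters.start (\<lambda>_. True) x a" if x: "x @ [a] \<in> A" for x a
  proof -
    obtain v where v: "v \<in> nonroot T" "h v = x @ [a]"
      using ex_nonroot[OF x] by blast
    define u where "u = parent T v"
    have u: "u \<in> verts T" "h u = x"
      using parent_props[OF v(1)] v(2) by (auto simp: u_def)
    show ?thesis
    proof (cases "x = []")
      case False
      then have un: "u \<in> nonroot T"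
        using u nonroot_iff by simp
      have "{u, v} \<in> edges T"
        using edges_iff u v nonroot_iff by blast
      then have "compatible T u v"
        using tiered un v(1) unfolding tiered_rooted_tree_def edge_nonroot_compatible_iff by blast
      then show ?thesis
        using compatible_nonroot[OF un v(1)] u(2) v(2) False by (simp add: letters.start_def)
    qed simp
  qed
  moreover have "letter_prec a b"
    if x: "x @ a # y @ [b] \<in> A" "letters.start (\<lambda>_. True) x b" for x a y b
  proof -
    have "x @ [a] \<in> A"
      using trieD_prefix[OF trie, of "x @ [a]" "y @ [b]"] x(1) by simp
    then obtain u where u: "u \<in> nonroot T" "h u = x @ [a]"
      using ex_nonroot by blast
    obtain v where v: "v \<in> nonroot T" "h v = x @ a # y @ [b]"
      using ex_nonroot[of "x @ a # y" b] x(1) by auto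
    have "descendant T v u"
      using descendant_if[of v u "y @ [b]"] u v nonroot_iff by simp
    moreover have "compatible T v (parent T u)"
      using compatible_iff_start[OF parent_props(1)[OF u(1)] v(1) pos[OF v(1)]]
        parent_props(2)[OF u(1)] u(2) v(2) x(2) by simp
    ultimately have "\<not> (label T v < label T u \<or> label T v = label T u \<and> level T v > level T u)"
      using inv u(1) v(1) unfolding inversion_def by blast
    moreover have "a = (label T u, level T u)" "b = (label T v, level T v)"
      using last_h[OF u(1)] last_h[OF v(1)] u(2) v(2) by auto
    ultimately show ?thesis
      by (auto simp: letter_prec_def)
  qed
  ultimately have "letters.forest (\<lambda>_. True) A"
    using trie unfolding letters.forest_def by blast
  then show ?thesis
    using pos positive_content_iff by blast
qed

text \<open>The same translation backwards. The sibling condition comes from injectivity of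
  \<open>h\<close>: siblings with equal letters have equal sequences.\<close>

lemma tiered_if_good_trie:
  assumes "good_trie A"
  shows "tiered_rooted_tree T \<and> \<not> (\<exists>u v. inversion T u v)"
proof
  have pos: "label T v \<ge> 1" "level T v \<ge> 1" if "v \<in> nonroot T" for v
    using assms that positive_content_iff by auto
  have start: "letters.start (\<lambda>_. True) x a" if "x @ [a] \<in> A" for x a
    using assms that unfolding letters.forest_def by blast
  have edge: "compatible T u v" if "u \<in> nonroot T" "v \<in> nonroot T" "h v = h u @ [a]" for u v a
    using start[of "h u" a] h_in[of v] that compatible_nonroot[OF that(1,2)] nonroot_iff
    by (auto simp: letters.start_def)
  have "compatible T u v" if "u \<in> nonroot T" "v \<in> nonroot T" "{u, v} \<in> edges T" for u v
  proof -
    have "\<exists>a. h v = h u @ [a] \<or> h u = h v @ [a]"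
      using that(3) by (rule edgeE)
    then show ?thesis
      using edge that(1,2) by (auto simp: compatible_def)
  qed
  moreover have "u = v" if "u \<in> nonroot T" "v \<in> nonroot T" "parent T u = parent T v"
    "(label T u, level T u) = (label T v, level T v)" for u v
    using h_nonroot[OF that(1)] h_nonroot[OF that(2)] that h_inj nonroot_iff by simp
  ultimately show "tiered_rooted_tree T"
    using is_tree rt_in rt_label pos
    unfolding tiered_rooted_tree_def edge_nonroot_compatible_iff by blast
  show "\<not> (\<exists>u v. inversion T u v)"
  proof clarify
    fix u v
    assume "inversion T u v"
    then have u: "u \<in> nonroot T" and v: "v \<in> nonroot T" and d: "descendant T v u"
      and c: "compatible T v (parent T u)"
      and less: "label T v < label T u \<or> label T v = label T u \<and> level T v > level T u"
      by (auto simp: inversion_def)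
    obtain y where y: "y \<noteq> []" "h v = h u @ y"
      using descendant_imp[OF d] by blast
    define x where "x = h (parent T u)"
    have "h v = x @ (label T u, level T u) # butlast y @ [last y]"
      using y h_nonroot[OF u] by (simp add: x_def)
    moreover have last: "last y = (label T v, level T v)"
      using last_h[OF v] y by simp
    moreover have "letters.start (\<lambda>_. True) x (label T v, level T v)"
      using compatible_iff_start[OF parent_props(1)[OF u] v pos[OF v]] c last_h[OF v]
      by (simp add: x_def)
    moreover have "h v \<in> A"
      using v h_in nonroot_iff by blast
    ultimately have "letter_prec (label T u, level T u) (label T v, level T v)"
      using assms unfolding letters.forest_def by metis
    then show False
      using less by (auto simp: letter_prec_def)
  qed
qed

end

section \<open>Isomorphism classes and their tries\<close>

definition trie_of :: "'v rtree \<Rightarrow> (nat \<times> nat) list set" where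
  "trie_of T = path T ` verts T"

definition class_trie :: "nat rtree set \<Rightarrow> (nat \<times> nat) list set" where
  "class_trie C = trie_of (SOME T. T \<in> C)"

lemma trie_model_RTT: "T \<in> RTT n \<Longrightarrow> trie_model T (path T) (trie_of T)"
  unfolding trie_of_def by (rule trie_model_path) (simp add: RTT_def)

lemma RTT_iso_iff: "\<lbrakk>S \<in> RTT n; T \<in> RTT n\<rbrakk> \<Longrightarrow> (S, T) \<in> RTT_iso n \<longleftrightarrow> trie_of S = trie_of T"
  using trie_model_iso_imp_eq[OF trie_model_RTT trie_model_RTT, of S n T n]
    trie_model_imp_iso[OF trie_model_RTT, of S n T] trie_model_RTT[of T n]
  unfolding RTT_iso_def by auto

lemma class_trie_eq:
  assumes "C \<in> zRTT0 n" "T \<in> C"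
  shows "T \<in> RTT n" "class_trie C = trie_of T"
proof -
  obtain S where S: "S \<in> RTT n" "C = RTT_iso n `` {S}"
    using assms(1) by (auto simp: zRTT0_def quotient_def)
  have *: "X \<in> RTT n" "trie_of X = trie_of S" if "X \<in> C" for X
  proof -
    show "X \<in> RTT n"
      using that S(2) by (auto simp: RTT_iso_def)
    then show "trie_of X = trie_of S"
      using that S RTT_iso_iff[OF S(1), of X] by auto
  qed
  show "T \<in> RTT n" "class_trie C = trie_of T"
    using * assms(2) someI[of "\<lambda>X. X \<in> C" T] by (auto simp: class_trie_def)
qed

lemma zRTT0_rep:
  assumes "C \<in> zRTT0 n"
  obtains T where "T \<in> RTT n" "\<not> (\<exists>u v. inversion T u v)" "C = RTT_iso n `` {T}" "T \<in> C"
proof -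
  obtain T where T: "T \<in> RTT n" "\<not> (\<exists>u v. inversion T u v)" "C = RTT_iso n `` {T}"
    using assms by (auto simp: zRTT0_def quotient_def)
  moreover have "T \<in> C"
    using T equiv_class_self[OF equiv_RTT_iso T(1)] by simp
  ultimately show ?thesis
    using that by blast
qed

lemma bij_betw_class_trie:
  "bij_betw class_trie (zRTT0 n) {A. good_trie A \<and> card A = n + 1}"
  unfolding bij_betw_def
proof (intro conjI set_eqI iffI)
  show "inj_on class_trie (zRTT0 n)"
  proof (rule inj_onI)
    fix C D
    assume C: "C \<in> zRTT0 n" and D: "D \<in> zRTT0 n" and eq: "class_trie C = class_trie D"
    obtain S where S: "S \<in> RTT n" "C = RTT_iso n `` {S}" "S \<in> C"
      using zRTT0_rep[OF C] .
    obtain T where T: "T \<in> RTT n" "D = RTT_iso n `` {T}" "T \<in> D"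
      using zRTT0_rep[OF D] .
    have "(S, T) \<in> RTT_iso n"
      using RTT_iso_iff[OF S(1) T(1)] class_trie_eq(2)[OF C S(3)] class_trie_eq(2)[OF D T(3)] eq
      by simp
    then show "C = D"
      using equiv_class_eq[OF equiv_RTT_iso] S(2) T(2) by metis
  qed
next
  fix A
  assume "A \<in> class_trie ` zRTT0 n"
  then obtain C where C: "C \<in> zRTT0 n" "A = class_trie C"
    by blast
  obtain T where T: "T \<in> RTT n" "\<not> (\<exists>u v. inversion T u v)" "T \<in> C"
    using zRTT0_rep[OF C(1)] .
  have A: "A = trie_of T"
    using class_trie_eq(2)[OF C(1) T(3)] C(2) by simp
  interpret trie_model T "path T" A
    unfolding A by (rule trie_model_RTT[OF T(1)])
  show "A \<in> {A. good_trie A \<and> card A = n + 1}"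
    using good_trie_if_tiered T(1,2) card_verts by (simp add: RTT_def)
next
  fix A
  assume "A \<in> {A. good_trie A \<and> card A = n + 1}"
  then have A: "good_trie A" "card A = n + 1"
    by auto
  obtain T :: "nat rtree" and h where m: "trie_model T h A"
    using ex_trie_model A(1) unfolding letters.forest_def by blast
  interpret trie_model T h A by (rule m)
  have T: "T \<in> RTT n" "\<not> (\<exists>u v. inversion T u v)"
    using tiered_if_good_trie A card_verts by (auto simp: RTT_def)
  define C where "C = RTT_iso n `` {T}"
  have C: "C \<in> zRTT0 n" "T \<in> C"
    using T equiv_class_self[OF equiv_RTT_iso T(1)]
    unfolding C_def zRTT0_def by (auto intro: quotientI)
  \<comment> \<open>\<open>T\<close> carries two models, \<open>h\<close> over \<open>A\<close> and
    \<open>path T\<close> over \<open>trie_of T\<close>; the identity isomorphism forces the two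
    tries to agree.\<close>
  have "tree_iso T T"
    unfolding tree_iso_def by (rule exI[of _ id]) simp
  then have "trie_of T = A"
    using trie_model_iso_imp_eq[OF trie_model_RTT[OF T(1)] m] by blast
  then have "class_trie C = A"
    using class_trie_eq(2)[OF C] by simp
  then show "A \<in> class_trie ` zRTT0 n"
    using C(1) by blast
qed

section \<open>Reversal of levels\<close>

definition rev_levels :: "nat list \<Rightarrow> nat list" where
  "rev_levels b = map (\<lambda>y. Min (set b) + Max (set b) - y) b"

lemma length_rev_levels [simp]: "length (rev_levels b) = length b"
  by (simp add: rev_levels_def)

text \<open>The reflection interchanges the two extreme values and so keeps the interval they span.
  This is what makes it an involution.\<close>

lemma Min_Max_rev_levels:
  assumes "b \<noteq> []"
  shows "Min (set (rev_levels b)) = Min (set b)" "Max (set (rev_levels b)) = Max (set b)"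
proof -
  define s m where "s = Min (set b)" and "m = Max (set b)"
  have sm: "s \<in> set b" "m \<in> set b" "\<And>y. y \<in> set b \<Longrightarrow> s \<le> y \<and> y \<le> m"
    using assms by (auto simp: s_def m_def)
  have set: "set (rev_levels b) = (\<lambda>y. s + m - y) ` set b"
    by (simp add: rev_levels_def s_def m_def)
  have "Min (set (rev_levels b)) = s"
    by (rule Min_eqI) (use sm set in \<open>force+\<close>)
  moreover have "Max (set (rev_levels b)) = m"
    by (rule Max_eqI) (use sm set in \<open>force+\<close>)
  ultimately show "Min (set (rev_levels b)) = Min (set b)" "Max (set (rev_levels b)) = Max (set b)"
    by (simp_all add: s_def m_def)
qed

lemma rev_levels_rev_levels: "rev_levels (rev_levels b) = b"
proof (cases "b = []")
  case False
  have "Min (set b) + Max (set b) - (Min (set b) + Max (set b) - y) = y" if "y \<in> set b" for y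
    using Max_ge[OF finite_set that] by simp
  then show ?thesis
    unfolding rev_levels_def[of "rev_levels b"] Min_Max_rev_levels[OF False]
    by (simp add: rev_levels_def map_idI)
qed (simp add: rev_levels_def)

lemma rev_levels_less_iff:
  assumes "i < length b" "j < length b"
  shows "rev_levels b ! i < rev_levels b ! j \<longleftrightarrow> b ! j < b ! i"
proof -
  have "b ! i \<le> Max (set b)" "b ! j \<le> Max (set b)"
    using assms by auto
  moreover have "rev_levels b ! k = Min (set b) + Max (set b) - b ! k" if "k < length b" for k
    using that by (simp add: rev_levels_def)
  ultimately show ?thesis
    using assms by presburger
qed

lemma rev_levels_positive:
  assumes "\<forall>y\<in>set b. 1 \<le> y"
  shows "\<forall>y\<in>set (rev_levels b). 1 \<le> y"
proof (cases "b = []")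
  case False
  then have "1 \<le> Min (set (rev_levels b))"
    using assms Min_in[of "set b"] by (simp add: Min_Max_rev_levels)
  then show ?thesis
    using False by (metis List.finite_set Min_le order_trans)
qed (simp add: rev_levels_def)

lemma count_rev_levels: "count (mset (rev_levels b)) = rev_comp (count (mset b))"
proof
  fix i
  define s m where "s = Min (set b)" and "m = Max (set b)"
  have sm: "s \<le> y" "y \<le> m" if "y \<in> set b" for y
    using that by (auto simp: s_def m_def)
  have supp: "{j. count (mset b) j \<noteq> 0} = set b"
    by (auto simp: count_eq_zero_iff)
  have "count (mset (rev_levels b)) i = length (filter (\<lambda>y. i = s + m - y) b)"
    by (simp add: rev_levels_def s_def m_def count_mset count_list_eq_length_filter
        filter_map comp_def del: mset_map)
  \<comment> \<open>For \<open>y\<close> between \<open>s\<close> and \<open>m\<close> the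
    subtraction does not truncate, so the equation can be solved for \<open>y\<close>; it then
    forces the bounds on \<open>i\<close>.\<close>
  also have "filter (\<lambda>y. i = s + m - y) b = filter (\<lambda>y. s \<le> i \<and> i \<le> m \<and> s + m - i = y) b"
    by (rule filter_cong) (use sm in force)+
  also have "length \<dots> = (if s \<le> i \<and> i \<le> m then count (mset b) (s + m - i) else 0)"
    by (auto simp: count_mset count_list_eq_length_filter filter_empty_conv)
  also have "\<dots> = rev_comp (count (mset b)) i"
    by (simp add: rev_comp_def supp s_def m_def Let_def)
  finally show "count (mset (rev_levels b)) i = rev_comp (count (mset b)) i" .
qed

section \<open>Normal forms as paths of area zero\<close>

definition word_path :: "(nat \<times> nat) list \<Rightarrow> nat list \<times> nat list" where
  "word_path w = (map fst w, rev_levels (map snd w))"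

text \<open>A descent in level becomes an ascent under \<open>rev_levels\<close>, so this turns into
  the area zero condition for \<open>word_path w\<close>.\<close>

lemma nf_letters_iff:
  "letters.nf w \<longleftrightarrow> (\<forall>i. Suc i < length w \<longrightarrow> fst (w ! i) < fst (w ! Suc i) \<or> snd (w ! Suc i) < snd (w ! i))"
  by (auto simp: letters.nf_def successively_conv_nth letter_le_def not_le)

lemma bij_betw_word_path:
  "bij_betw word_path {w. letters.nf w \<and> length w = n \<and> (\<forall>p\<in>set w. 1 \<le> fst p \<and> 1 \<le> snd p)} (zLD2 n)"
proof (rule bij_betwI[where g = "\<lambda>(a, b). zip a (rev_levels b)"])
  show "word_path \<in> {w. letters.nf w \<and> length w = n \<and> (\<forall>p\<in>set w. 1 \<le> fst p \<and> 1 \<le> snd p)} \<rightarrow> zLD2 n"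
  proof clarify
    fix w
    assume w: "letters.nf w" "n = length w" "\<forall>p\<in>set w. 1 \<le> fst p \<and> 1 \<le> snd p"
    then show "word_path w \<in> zLD2 (length w)"
      using rev_levels_positive[of "map snd w"] rev_levels_less_iff[of _ "map snd w"]
      by (auto simp: zLD2_def word_path_def nf_letters_iff)
  qed
  show "(\<lambda>(a, b). zip a (rev_levels b)) \<in> zLD2 n \<rightarrow>
      {w. letters.nf w \<and> length w = n \<and> (\<forall>p\<in>set w. 1 \<le> fst p \<and> 1 \<le> snd p)}"
  proof clarify
    fix a b
    assume "(a, b) \<in> zLD2 n"
    then have ab: "length a = n" "length b = n" "\<forall>x\<in>set a. 1 \<le> x" "\<forall>y\<in>set b. 1 \<le> y"
      "\<And>i. Suc i < n \<Longrightarrow> a ! i < a ! Suc i \<or> b ! i < b ! Suc i"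
      by (auto simp: zLD2_def)
    then show "letters.nf (zip a (rev_levels b)) \<and> length (zip a (rev_levels b)) = n \<and>
        (\<forall>p\<in>set (zip a (rev_levels b)). 1 \<le> fst p \<and> 1 \<le> snd p)"
      using rev_levels_positive[OF ab(4)] rev_levels_less_iff[of _ b]
      by (auto simp: nf_letters_iff dest: set_zip_leftD set_zip_rightD)
  qed
qed (auto simp: word_path_def zLD2_def rev_levels_rev_levels zip_map_fst_snd)

lemma alpha_LD_eq: "alpha_LD ab = count (mset (fst ab))"
  by (simp add: fun_eq_iff alpha_LD_def count_mset count_list_eq_length_filter length_filter_conv_card eq_commute)

lemma beta_LD_eq: "beta_LD ab = count (mset (snd ab))"
  by (simp add: fun_eq_iff beta_LD_def count_mset count_list_eq_length_filter length_filter_conv_card eq_commute)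

theorem theorem4p1:
  fixes n :: nat
  assumes "n \<ge> 1"
  shows "\<exists>\<phi>. bij_betw \<phi> (zRTT0 n) (zLD2 n) \<and>
    (\<forall>C\<in>zRTT0 n. \<forall>T\<in>C. alpha_LD (\<phi> C) = alpha_tree T \<and>
       beta_LD (\<phi> C) = rev_comp (beta_tree T))"
proof -
  \<comment> \<open>Every letter is admissible at the bottom, so all normal forms are
    supported.\<close>
  obtain f where f: "bij_betw f {A. letters.forest (\<lambda>_. True) A} {w. letters.nf w}"
    and mset_f: "\<And>A. letters.forest (\<lambda>_. True) A \<Longrightarrow> mset (f A) = content A"
    using letters.ex_content_preserving_bij[of "\<lambda>_. True"] by (auto simp: letters.supported_True)
  \<comment> \<open>Size and positivity depend on the multiset of letters only, so \<open>f\<close>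
    restricts to the objects satisfying them.\<close>
  let ?P = "\<lambda>M. size M = n \<and> (\<forall>p\<in>#M. 1 \<le> fst p \<and> 1 \<le> snd p)"
  have tries: "{A. good_trie A \<and> card A = n + 1} = {A \<in> {A. letters.forest (\<lambda>_. True) A}. ?P (content A)}"
  proof -
    have "card A = n + 1 \<longleftrightarrow> size (content A) = n" if "letters.forest (\<lambda>_. True) A" for A
    proof -
      have "trie A"
        using that by (rule letters.forest_imp_trie)
      then show ?thesis
        \<comment> \<open>The root \<open>[]\<close> belongs to \<open>A\<close>, so
          \<open>card A \<ge> 1\<close> and the subtraction in \<open>size_content\<close> does not
          truncate.\<close>
        using size_content[of A] card_gt_0_iff[of A] by (auto simp: trie_def)
    qed
    then show ?thesis
      by blast
  qed
  have words: "{w. letters.nf w \<and> length w = n \<and> (\<forall>p\<in>set w. 1 \<le> fst p \<and> 1 \<le> snd p)} =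
      {w \<in> {w. letters.nf w}. ?P (mset w)}"
    by auto
  have "bij_betw f {A \<in> {A. letters.forest (\<lambda>_. True) A}. ?P (content A)} {w \<in> {w. letters.nf w}. ?P (mset w)}"
    by (rule bij_betw_Collect[OF f]) (use mset_f in simp)
  from bij_betw_trans[OF bij_betw_trans[OF bij_betw_class_trie[of n, unfolded tries] this]
      bij_betw_word_path[of n, unfolded words]]
  have "bij_betw (word_path \<circ> f \<circ> class_trie) (zRTT0 n) (zLD2 n)"
    by (simp only: comp_assoc)
  moreover have "alpha_LD ((word_path \<circ> f \<circ> class_trie) C) = alpha_tree T \<and>
      beta_LD ((word_path \<circ> f \<circ> class_trie) C) = rev_comp (beta_tree T)"
    if C: "C \<in> zRTT0 n" "T \<in> C" for C T
  proof -
    \<comment> \<open>The trie of the class is the trie of each of its members, so the compositions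
      agree for every \<open>T\<close> in \<open>C\<close>.\<close>
    define A where "A = class_trie C"
    have "A = trie_of T"
      using class_trie_eq(2)[OF C] by (simp add: A_def)
    then interpret trie_model T "path T" A
      using trie_model_RTT class_trie_eq(1)[OF C] by blast
    have A: "letters.forest (\<lambda>_. True) A"
      using bij_betwE[OF bij_betw_class_trie[of n, unfolded tries]] C(1) by (auto simp: A_def)
    show ?thesis
      using mset_f[OF A] count_rev_levels[of "map snd (f A)"]
      by (simp add: alpha_LD_eq beta_LD_eq alpha_tree_eq beta_tree_eq word_path_def flip: A_def)
  qed
  ultimately show ?thesis
    by blast
qed

end
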